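(* Let $T(\cdot)$ be such that its eigenvalues $\lambda_1,\dots,\lambda_m$ in $\mathcal{D}$ are simple with linearly independent unit eigenvectors $u_1,\dots,u_m$, let $\mathcal{U}_{\mathcal{D}}=\operatorname{span}\{u_1,\dots,u_m\}$, and consider the NLFEAST iteration (defined in the context) with the filter $F_{\mathsf{nl}}^{[N]}(\cdot)$ applied to $T(\cdot)$. Suppose its extraction step satisfies the Extraction Assumption (stated in the context). Then there exist constants $\epsilon_{\mathsf{nl}}>0$ and $c_{\mathsf{nl}}>0$ depending only on $T(\cdot):\mathcal{D}\to\mathbb{C}^{n\times n}$ such that the following holds. Assume that the quadrature satisfies $$\max\Bigl\{\Bigl\|\sum_{j=1}^{N}\frac{\omega_j}{\xi_j-\rho}H(\xi_j)-H(\rho)\Bigr\|,\ \bigl\|F_{\mathsf{ci}}(\rho)-F_{\mathsf{nl}}^{[N]}(\rho)\bigr\|\Bigr\}\le\gamma_N\qquad\text{for all }\rho\in\mathcal{D}_0$$ with $\gamma_N<1/c_{\mathsf{nl}}$, where $\gamma_N=C_T\exp(-c_TN)$ for some constants $c_T,C_T>0$ depending only on $T:\mathcal{D}\to\mathbb{C}^{n\times n}$. Then $$\angle(\mathcal{X}^{(k)},\mathcal{U}_{\mathcal{D}})\le(c_{\mathsf{nl}}\gamma_N)^k\,\angle(\mathcal{X}^{(0)},\mathcal{U}_{\mathcal{D}})$$ holds (for all $k\ge0$) for any initial subspace $\mathcal{X}^{(0)}$ satisfying $\angle(\mathcal{U}_{\mathcal{D}},\mathcal{X}^{(0)})\le\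epsilon_{\mathsf{nl}}$.
   Context: Setting: $\mathcal{D}\subset\mathbb{C}$ is a nonempty domain enclosed by a Jordan curve $\partial\mathcal{D}$ (positively oriented, rectifiable, with $T(\xi)$ invertible on $\partial\mathcal{D}$ so that the contour integral below is defined); $T(\cdot)$ is an $n\times n$ holomorphic matrix-valued function on some domain containing the closure of $\mathcal{D}$, with $\det T(\xi_0)\ne0$ for some $\xi_0\in\mathcal{D}$. An eigenpair $(\lambda,u)$ satisfies $T(\lambda)u=0$, $u\ne0$; $\lambda$ is simple if it is a simple zero of $\det T$. $\lambda_1,\dots,\lambda_m$ are all the eigenvalues in $\mathcal{D}$, and $T(\lambda_i)u_i=0$, $\|u_i\|=1$. $\|\cdot\|$ is the Euclidean/spectral norm; $\angle(\cdot,\cdot)$ is the largest principal angle between subspaces (or ranges of matrices or vectors). $\mathcal{O}(\cdot)$ absorbs constants depending only on $T(\cdot):\mathcal{D}\to\mathbb{C}^{n\times n}$. Filter and quadrature: $(\xi_j,\omega_j)$, $1\le j\le N$, are nodes and weights of a quadrature rule for contour integrals over $\partial\mathcal{D}$ (with $1/(2\pi\mathrm{i})$ absorbed in $\omega_j$ and $T(\xi_j)$ invertible), so that $\sum_j\omega_j/(\xi_j-\xi)$ approximates the indicator function of $\mathcal{D}$, and $$F_{\mathsf{nl}}^{[N]}(\rho)=\sum_{j=1}^{N}\frac{\omega_j}{\xi_j-\rho}\bigl(I-T(\xi_j)^{-1}T(\rho)\bigr),\qquad F_{\mathsf{ci}}(\rho)=\frac{1}{2\pi\mathrm{i}}\oint_{\partial\mathcal{D}}\frac{1}{\xi-\rho}\bigl(I-T(\xi)^{-1}T(\rho)\bigr)\,\mathrm{d}\xi,$$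 with continuous extension at $\rho=\xi_j$. $H$ is the holomorphic part in Keldysh's decomposition $T(\xi)^{-1}=U_{\mathcal{D}}(\xi I-J_{\mathcal{D}})^{-1}W_{\mathcal{D}}^{\mathsf{H}}+H(\xi)$ for $\xi\in\mathcal{D}\setminus\{\lambda_1,\dots,\lambda_m\}$, where $U_{\mathcal{D}}=[u_1,\dots,u_m]$, $J_{\mathcal{D}}=\operatorname{diag}(\lambda_1,\dots,\lambda_m)$, and $W_{\mathcal{D}}\in\mathbb{C}^{n\times m}$ consists of suitably scaled left eigenvectors; the same formula defines $H$ at the nodes $\xi_j$. $\mathcal{D}_0\subset\mathcal{D}$ is a fixed compact set containing small neighborhoods of $\lambda_1,\dots,\lambda_m$. NLFEAST: starting from an $m$-dimensional subspace $\mathcal{X}^{(0)}\subset\mathbb{C}^n$, for $k=0,1,2,\dots$: (1) extract Ritz pairs $(\rho_i^{(k)},x_i^{(k)})$, $1\le i\le m$, from $\mathcal{X}^{(k)}$ by the nonlinear Rayleigh–Ritz procedure, i.e. with $X^{(k)}$ an orthonormal basis matrix of $\mathcal{X}^{(k)}$, the $\rho_i^{(k)}$ are the eigenvalues in $\mathcal{D}$ of the compressed problem $(X^{(k)})^{\mathsf{H}}T(\cdot)X^{(k)}$ and $x_i^{(k)}$ is $X^{(k)}$ times the associated eigenvector; (2) set $\widehat{x}_i^{(k+1)}=F_{\mathsf{nl}}^{[N]}(\rho_i^{(k)})x_i^{(k)}$; (3) set $\mathcal{X}^{(k+1)}=\operatorname{span}\{\widehat{x}_1^{(k+1)},\dots,\widehat{x}_m^{(k+1)}\}$.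 Extraction Assumption: there is a sufficiently small constant $0<\epsilon_T<\pi/2$ depending only on $T(\cdot):\mathcal{D}\to\mathbb{C}^{n\times n}$ such that for every $m$-dimensional subspace $\mathcal{X}\subset\mathbb{C}^n$ with $\epsilon=\angle(\mathcal{X},\mathcal{U}_{\mathcal{D}})\le\epsilon_T$, the eigenpairs $(\rho_i,x_i)$ extracted from $\mathcal{X}$ in step (1), appropriately ordered, satisfy $|\rho_i-\lambda_i|=\mathcal{O}(\epsilon)$ and $\angle(x_i,u_i)=\mathcal{O}(\epsilon)$ for $i=1,\dots,m$, with constants independent of $\mathcal{X}$. *)

theory Defs
  imports "HOL-Complex_Analysis.Complex_Analysis"
begin

section \<open>Complex matrices and angles between subspaces\<close>

text \<open>The prefix \<open>vec\<close> denotes linear algebra over the field of complex scalars; the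
  unqualified \<open>span\<close>, \<open>subspace\<close> and \<open>dim\<close> are over the reals.\<close>

definition cinner :: "complex ^ 'n \<Rightarrow> complex ^ 'n \<Rightarrow> complex" where
  "cinner x y = (\<Sum>i\<in>UNIV. cnj (x $ i) * y $ i)"

definition ctranspose :: "complex ^ 'm ^ 'n \<Rightarrow> complex ^ 'n ^ 'm" where
  "ctranspose A = (\<chi> i j. cnj (A $ j $ i))"

definition mscale :: "complex \<Rightarrow> complex ^ 'm ^ 'n \<Rightarrow> complex ^ 'm ^ 'n" where
  "mscale c A = (\<chi> i j. c * A $ i $ j)"

definition diag :: "('m \<Rightarrow> complex) \<Rightarrow> complex ^ 'm ^ 'm" where
  "diag d = (\<chi> i j. if i = j then d i else 0)"

definition of_columns :: "('m \<Rightarrow> complex ^ 'n) \<Rightarrow> complex ^ 'm ^ 'n" where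
  "of_columns u = (\<chi> a i. u i $ a)"

definition spectral_norm :: "complex ^ 'm ^ 'n \<Rightarrow> real" where
  "spectral_norm A = onorm (\<lambda>x. A *v x)"

definition orthonormal_basis_matrix :: "complex ^ 'm ^ 'n \<Rightarrow> (complex ^ 'n) set \<Rightarrow> bool" where
  "orthonormal_basis_matrix Q X \<longleftrightarrow> ctranspose Q ** Q = mat 1 \<and> vec.span (columns Q) = X"

text \<open>The cosines of the principal angles are the singular values of \<open>ctranspose P ** Q\<close>, where
  \<open>P\<close> and \<open>Q\<close> are orthonormal basis matrices of \<open>X\<close> and \<open>Y\<close>.  For a singular triplet
  \<open>(s, a, b)\<close> of that matrix, put \<open>x = P *v a\<close> and \<open>y = Q *v b\<close>: the two
  defining equations say that \<open>s x\<close> is the orthogonal projection of \<open>y\<close> onto \<open>X\<close>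
  and \<open>s y\<close> is the orthogonal projection of \<open>x\<close> onto \<open>Y\<close>.\<close>

definition principal_angle :: "(complex ^ 'n) set \<Rightarrow> (complex ^ 'n) set \<Rightarrow> real \<Rightarrow> bool" where
  "principal_angle X Y \<theta> \<longleftrightarrow> 0 \<le> \<theta> \<and> \<theta> \<le> pi / 2 \<and>
     (\<exists>x\<in>X. \<exists>y\<in>Y. norm x = 1 \<and> norm y = 1 \<and>
        (\<forall>z\<in>X. cinner z (y - of_real (cos \<theta>) *s x) = 0) \<and>
        (\<forall>z\<in>Y. cinner z (x - of_real (cos \<theta>) *s y) = 0))"

text \<open>For nonzero subspaces the set below is finite and nonempty, so the supremum is the
  largest principal angle.\<close>

definition subspace_angle :: "(complex ^ 'n) set \<Rightarrow> (complex ^ 'n) set \<Rightarrow> real" where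
  "subspace_angle X Y = Sup {\<theta>. principal_angle X Y \<theta>}"


section \<open>Contour integrals along rectifiable curves\<close>

text \<open>\<^const>\<open>contour_integral\<close> comes with a theory for piecewise continuously differentiable
  paths only.  For a curve that is merely rectifiable we use the Riemann-Stieltjes integral
  of \<open>f (g t)\<close> with respect to \<open>g t\<close>.\<close>

definition rectifiable_path :: "(real \<Rightarrow> complex) \<Rightarrow> bool" where
  "rectifiable_path g \<longleftrightarrow> path g \<and>
     (\<exists>B. \<forall>p. p division_of {0..1} \<longrightarrow> (\<Sum>K\<in>p. norm (g (Sup K) - g (Inf K))) \<le> B)"

definition has_curve_integral :: "(complex \<Rightarrow> complex) \<Rightarrow> complex \<Rightarrow> (real \<Rightarrow> complex) \<Rightarrow> bool" where
  "has_curve_integral f I g \<longleftrightarrow>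
     (\<forall>e>0. \<exists>d>0. \<forall>p. p tagged_division_of {0..1} \<and> (\<lambda>t. ball t d) fine p \<longrightarrow>
        norm ((\<Sum>(t, K)\<in>p. f (g t) * (g (Sup K) - g (Inf K))) - I) < e)"

definition curve_integral :: "(real \<Rightarrow> complex) \<Rightarrow> (complex \<Rightarrow> complex) \<Rightarrow> complex" where
  "curve_integral g f = (THE I. has_curve_integral f I g)"


section \<open>Nonlinear eigenvalue problems\<close>

definition matrix_holomorphic_on ::
    "(complex \<Rightarrow> complex ^ 'm ^ 'n) \<Rightarrow> complex set \<Rightarrow> bool" where
  "matrix_holomorphic_on T S \<longleftrightarrow> (\<forall>i j. (\<lambda>z. T z $ i $ j) holomorphic_on S)"

definition eigenpair :: "(complex \<Rightarrow> complex ^ 'n ^ 'n) \<Rightarrow> complex \<Rightarrow> complex ^ 'n \<Rightarrow> bool" where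
  "eigenpair T z v \<longleftrightarrow> T z *v v = 0 \<and> v \<noteq> 0"

definition eigenvalues_in :: "complex set \<Rightarrow> (complex \<Rightarrow> complex ^ 'n ^ 'n) \<Rightarrow> complex set" where
  "eigenvalues_in D T = {z \<in> D. \<exists>v. eigenpair T z v}"

definition simple_eigenvalue :: "(complex \<Rightarrow> complex ^ 'n ^ 'n) \<Rightarrow> complex \<Rightarrow> bool" where
  "simple_eigenvalue T z \<longleftrightarrow> det (T z) = 0 \<and> zorder (\<lambda>z. det (T z)) z = 1"

text \<open>\<open>\<Omega>\<close> is the domain of holomorphy of \<open>T\<close>.  On \<open>D\<close> the matrix \<open>T z\<close> is invertible exactly
  off the eigenvalues; the same formula is used for \<open>H\<close> at all other points of \<open>\<Omega>\<close> where
  \<open>T z\<close> is invertible, in particular at quadrature nodes outside \<open>D\<close>.  At the eigenvalues,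
  \<open>H\<close> is determined by holomorphy.\<close>

definition keldysh_decomposition ::
    "complex set \<Rightarrow> complex set \<Rightarrow> (complex \<Rightarrow> complex ^ 'n ^ 'n) \<Rightarrow> ('m::finite \<Rightarrow> complex) \<Rightarrow>
     ('m \<Rightarrow> complex ^ 'n) \<Rightarrow> ('m \<Rightarrow> complex ^ 'n) \<Rightarrow> (complex \<Rightarrow> complex ^ 'n ^ 'n) \<Rightarrow> bool" where
  "keldysh_decomposition \<Omega> D T \<mu> u w H \<longleftrightarrow>
     (\<forall>i. w i \<noteq> 0 \<and> ctranspose (T (\<mu> i)) *v w i = 0) \<and>
     matrix_holomorphic_on H D \<and>
     (\<forall>z\<in>\<Omega>. invertible (T z) \<longrightarrow>
        matrix_inv (T z) =
          of_columns u ** matrix_inv (mat z - diag \<mu>) ** ctranspose (of_columns w) + H z)"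


section \<open>Filters\<close>

definition filter_ci ::
    "(real \<Rightarrow> complex) \<Rightarrow> (complex \<Rightarrow> complex ^ 'n ^ 'n) \<Rightarrow> complex \<Rightarrow> complex ^ 'n ^ 'n" where
  "filter_ci g T \<rho> = (\<chi> a b. 1 / (2 * of_real pi * \<i>) *
     curve_integral g
       (\<lambda>z. mscale (1 / (z - \<rho>)) (mat 1 - matrix_inv (T z) ** T \<rho>) $ a $ b))"

definition filter_nl_sum ::
    "nat \<Rightarrow> (nat \<Rightarrow> complex) \<Rightarrow> (nat \<Rightarrow> complex) \<Rightarrow> (complex \<Rightarrow> complex ^ 'n ^ 'n) \<Rightarrow>
     complex \<Rightarrow> complex ^ 'n ^ 'n" where
  "filter_nl_sum N \<xi> \<omega> T \<rho> =
     (\<Sum>j=1..N. mscale (\<omega> j / (\<xi> j - \<rho>)) (mat 1 - matrix_inv (T (\<xi> j)) ** T \<rho>))"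

definition filter_nl ::
    "nat \<Rightarrow> (nat \<Rightarrow> complex) \<Rightarrow> (nat \<Rightarrow> complex) \<Rightarrow> (complex \<Rightarrow> complex ^ 'n ^ 'n) \<Rightarrow>
     complex \<Rightarrow> complex ^ 'n ^ 'n" where
  "filter_nl N \<xi> \<omega> T \<rho> =
     (if \<rho> \<in> \<xi> ` {1..N} then Lim (at \<rho>) (filter_nl_sum N \<xi> \<omega> T)
      else filter_nl_sum N \<xi> \<omega> T \<rho>)"


section \<open>Rayleigh-Ritz extraction and the iteration\<close>

text \<open>\<open>\<rho>\<close> enumerates all eigenvalues in \<open>D\<close> of the compressed problem, and \<open>x i\<close> is a Ritz vector
  for \<open>\<rho> i\<close> (of arbitrary nonzero length).  The order is arbitrary.\<close>

definition ritz_pairs ::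
    "complex set \<Rightarrow> (complex \<Rightarrow> complex ^ 'n ^ 'n) \<Rightarrow> (complex ^ 'n) set \<Rightarrow>
     ('m::finite \<Rightarrow> complex) \<Rightarrow> ('m \<Rightarrow> complex ^ 'n) \<Rightarrow> bool" where
  "ritz_pairs D T X \<rho> x \<longleftrightarrow>
     (\<exists>Q :: complex ^ 'm ^ 'n.
        orthonormal_basis_matrix Q X \<and>
        range \<rho> = eigenvalues_in D (\<lambda>z. ctranspose Q ** T z ** Q) \<and>
        (\<forall>i. \<exists>y. eigenpair (\<lambda>z. ctranspose Q ** T z ** Q) (\<rho> i) y \<and> x i = Q *v y))"

definition extraction_assumption ::
    "complex set \<Rightarrow> (complex \<Rightarrow> complex ^ 'n ^ 'n) \<Rightarrow>
     ('m::finite \<Rightarrow> complex) \<Rightarrow> ('m \<Rightarrow> complex ^ 'n) \<Rightarrow> bool" where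
  "extraction_assumption D T \<mu> u \<longleftrightarrow>
     (\<exists>\<epsilon>\<^sub>T C. 0 < \<epsilon>\<^sub>T \<and> \<epsilon>\<^sub>T < pi / 2 \<and>
       (\<forall>X. vec.subspace X \<and> vec.dim X = CARD('m) \<and>
            subspace_angle X (vec.span (range u)) \<le> \<epsilon>\<^sub>T \<longrightarrow>
          (\<exists>(\<rho> :: 'm \<Rightarrow> complex) x. ritz_pairs D T X \<rho> x) \<and>
          (\<forall>(\<rho> :: 'm \<Rightarrow> complex) x. ritz_pairs D T X \<rho> x \<longrightarrow>
             (\<exists>\<pi>. bij \<pi> \<and>
               (\<forall>i. cmod (\<rho> (\<pi> i) - \<mu> i) \<le> C * subspace_angle X (vec.span (range u)) \<and>
                    subspace_angle (vec.span {x (\<pi> i)}) (vec.span {u i})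
                      \<le> C * subspace_angle X (vec.span (range u)))))))"

definition nlfeast ::
    "complex set \<Rightarrow> (complex \<Rightarrow> complex ^ 'n ^ 'n) \<Rightarrow>
     nat \<Rightarrow> (nat \<Rightarrow> complex) \<Rightarrow> (nat \<Rightarrow> complex) \<Rightarrow>
     (nat \<Rightarrow> (complex ^ 'n) set) \<Rightarrow> (nat \<Rightarrow> 'm::finite \<Rightarrow> complex) \<Rightarrow>
     (nat \<Rightarrow> 'm \<Rightarrow> complex ^ 'n) \<Rightarrow> bool" where
  "nlfeast D T N \<xi> \<omega> X \<rho> x \<longleftrightarrow>
     (\<forall>k. ritz_pairs D T (X k) (\<rho> k) (x k) \<and>
          X (Suc k) = vec.span (range (\<lambda>i. filter_nl N \<xi> \<omega> T (\<rho> k i) *v x k i)))"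

end

theory Submission
  imports Defs
begin

text \<open>
  Write \<open>U\<close> for the span of the eigenvectors \<open>u i\<close> and \<open>R\<close> for the map that sends a vector to its
  component orthogonal to \<open>U\<close>.  One step replaces Ritz pairs \<open>(\<rho> i, x i)\<close>, which by the extraction
  assumption are within \<open>O(\<epsilon>)\<close> of \<open>(\<mu> i, u i)\<close> when \<open>\<epsilon>\<close> is the current angle, by the vectors
  \<open>F (\<rho> i) *v x i\<close> with \<open>F\<close> the quadrature filter.  The convergence factor \<open>c \<gamma>\<close> comes from two
  estimates for these vectors.

  First, they stay close to \<open>u i\<close>.  By Cauchy's formula and Keldysh's decomposition the exact contour
  filter is \<open>F\<^sub>c\<^sub>i \<rho> = I - H \<rho> T \<rho>\<close> (lemma \<open>filter_ci_eq\<close>), which maps \<open>u i\<close> to itself at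
  \<open>\<rho> = \<mu> i\<close>; hence \<open>F (\<rho> i) x i = u i + O(\<gamma> + \<epsilon>)\<close>, and for small \<open>\<gamma>\<close> and \<open>\<epsilon>\<close> the filtered
  vectors are a well-conditioned basis of the next subspace.

  Second, their component outside \<open>U\<close> is \<open>O(\<gamma> \<epsilon>)\<close>.  The singular part of the inverse of \<open>T\<close> has
  range \<open>U\<close> and is annihilated by \<open>R\<close>.  With \<open>r\<close> the sum of \<open>\<omega> j / (\<xi> j - \<rho>)\<close> and
  \<open>E\<close> the quadrature error of \<open>H\<close>, what remains of the filter is
  \<open>R (F \<rho> v) = (r - 1) R v - R (E (T \<rho> v))\<close>.  Here \<open>|E|\<close> is at most \<open>\<gamma>\<close>, and \<open>r - 1\<close> is \<open>O(\<gamma>)\<close>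
  wherever it matters: apply the identity to \<open>R v\<close> and compare with the contour filter, whose
  values lie in \<open>U\<close>.  The two factors \<open>R v\<close> and \<open>T \<rho> v\<close> are \<open>O(\<epsilon>)\<close> near an eigenpair
  (lemma \<open>filter_sum_estimates\<close>).

  Together these bounds give an angle of \<open>O(\<gamma> \<epsilon>)\<close> after the step (lemma
  \<open>filtered_span_contraction\<close>).  When \<open>c \<gamma> < 1\<close> the angle does not grow, so the step can be repeated.

  Two foundations are developed along the way.  The boundary curve is only rectifiable, so Cauchy's
  theorem is transferred to it from nearby smooth paths (lemma \<open>curve_integral_homologous_path\<close>); and
  the largest principal angle is compared with the distance of unit vectors of one subspace to the
  other (lemmas \<open>residual_le_subspace_angle\<close> and \<open>subspace_angle_le\<close>).
\<close>


section \<open>Holomorphic integrands on rectifiable curves\<close>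

lemma has_curve_integral_unique:
  assumes "has_curve_integral f I g" "has_curve_integral f J g"
  shows "I = J"
proof (rule ccontr)
  assume "I \<noteq> J"
  define e where "e = norm (I - J) / 2"
  have e: "e > 0" using \<open>I \<noteq> J\<close> by (simp add: e_def)
  let ?s = "\<lambda>p. \<Sum>(t, K)\<in>p. f (g t) * (g (Sup K) - g (Inf K))"
  obtain d1 where d1: "d1 > 0"
    and close1: "\<forall>p. p tagged_division_of {0..1} \<and> (\<lambda>t. ball t d1) fine p \<longrightarrow> norm (?s p - I) < e"
    using assms(1)[unfolded has_curve_integral_def, rule_format, OF e] by (elim exE conjE)
  obtain d2 where d2: "d2 > 0"
    and close2: "\<forall>p. p tagged_division_of {0..1} \<and> (\<lambda>t. ball t d2) fine p \<longrightarrow> norm (?s p - J) < e"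
    using assms(2)[unfolded has_curve_integral_def, rule_format, OF e] by (elim exE conjE)
  have "gauge (\<lambda>t::real. ball t (min d1 d2))"
    using d1 d2 by (simp add: gauge_def)
  then obtain p where p: "p tagged_division_of cbox 0 (1::real)" "(\<lambda>t. ball t (min d1 d2)) fine p"
    using fine_division_exists by blast
  have fine_subset_ball: "(\<lambda>t. ball t d) fine q" if "(\<lambda>t. ball t (min d1 d2)) fine q" "min d1 d2 \<le> d"
    for d :: real and q :: "(real \<times> real set) set"
  proof (rule fineI)
    fix t K assume "(t, K) \<in> q"
    then have "K \<subseteq> ball t (min d1 d2)" using fineD[OF that(1)] by blast
    then show "K \<subseteq> ball t d" using subset_ball[OF that(2)] by (rule order_trans)
  qed
  have "norm (?s p - I) < e"
    using p(1) fine_subset_ball[OF p(2), of d1] by (intro close1[rule_format] conjI) (simp_all add: box_real)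
  moreover have "norm (?s p - J) < e"
    using p(1) fine_subset_ball[OF p(2), of d2] by (intro close2[rule_format] conjI) (simp_all add: box_real)
  moreover have "norm (I - J) \<le> norm (?s p - I) + norm (?s p - J)"
    using dist_triangle[of I J "?s p"] by (simp add: dist_norm norm_minus_commute)
  ultimately show False by (simp add: e_def)
qed

lemma curve_integral_eqI:
  "has_curve_integral f I g \<Longrightarrow> curve_integral g f = I"
  unfolding curve_integral_def by (rule the_equality) (auto intro: has_curve_integral_unique)

text \<open>Adding to the integral along \<open>p\<close> up to time \<open>s\<close> a short detour from \<open>p s\<close> back to \<open>g s\<close> gives a
  function of \<open>s\<close> that increases along \<open>g\<close> as every local primitive of \<open>f\<close> does.  The detours vanish at
  both ends, so its total increase is the integral along \<open>p\<close>.\<close>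
lemma primitive_along_path:
  fixes g p :: "real \<Rightarrow> complex"
  assumes S: "open S" "f holomorphic_on S" and e: "e > 0"
    and balls: "\<And>t. t \<in> {0..1} \<Longrightarrow> ball (g t) e \<subseteq> S"
    and p: "valid_path p" "pathstart p = pathstart g" "pathfinish p = pathfinish g"
    and near: "\<And>t. t \<in> {0..1} \<Longrightarrow> norm (p t - g t) < e / 2"
  obtains \<Phi> where "\<Phi> (1::real) - \<Phi> 0 = contour_integral p f"
    and "\<And>t F a b. t \<in> {0..1} \<Longrightarrow>
       (\<And>z. z \<in> ball (g t) e \<Longrightarrow> (F has_field_derivative f z) (at z within ball (g t) e)) \<Longrightarrow>
       0 \<le> a \<Longrightarrow> a \<le> b \<Longrightarrow> b \<le> 1 \<Longrightarrow> (\<And>s. s \<in> {a..b} \<Longrightarrow> norm (g s - g t) < e / 2) \<Longrightarrow>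
       \<Phi> b - \<Phi> a = F (g b) - F (g a)"
proof
  \<comment> \<open>The detour at time \<open>s\<close> is the segment from \<open>g s\<close> to \<open>p s\<close>.\<close>
  define \<Phi> where "\<Phi> s = contour_integral (subpath 0 s p) f - contour_integral (linepath (g s) (p s)) f" for s
  have pS: "path_image p \<subseteq> S"
  proof
    fix z assume "z \<in> path_image p"
    then obtain t where t: "t \<in> {0..1}" "z = p t" by (auto simp: path_image_def)
    then have "z \<in> ball (g t) e"
      using near[of t] e by (simp add: dist_norm norm_minus_commute)
    then show "z \<in> S" using balls t by blast
  qed
  have int: "f contour_integrable_on p"
    using S p(1) pS by (simp add: contour_integrable_holomorphic_simple)
  show "\<Phi> 1 - \<Phi> 0 = contour_integral p f"
    using p by (simp add: \<Phi>_def pathstart_def pathfinish_def)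
  fix t F a b
  assume t: "t \<in> {0..1}"
    and F: "\<And>z. z \<in> ball (g t) e \<Longrightarrow> (F has_field_derivative f z) (at z within ball (g t) e)"
    and ab: "0 \<le> a" "a \<le> b" "b \<le> 1" and gs: "\<And>s. s \<in> {a..b} \<Longrightarrow> norm (g s - g t) < e / 2"
  have gin: "g s \<in> ball (g t) e" if "s \<in> {a..b}" for s
    using gs[OF that] e by (simp add: dist_norm norm_minus_commute)
  have pin: "p s \<in> ball (g t) e" if "s \<in> {a..b}" for s
  proof -
    have "norm (p s - g t) \<le> norm (p s - g s) + norm (g s - g t)"
      using norm_triangle_ineq[of "p s - g s" "g s - g t"] by simp
    then show ?thesis using gs[OF that] near[of s] that ab by (simp add: dist_norm norm_minus_commute)
  qed
  have L: "contour_integral (linepath (g s) (p s)) f = F (p s) - F (g s)" if "s \<in> {a..b}" for s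
  proof -
    have "closed_segment (g s) (p s) \<subseteq> ball (g t) e"
      using gin pin that by (simp add: closed_segment_subset)
    then show ?thesis
      using contour_integral_primitive[OF F, where g = "linepath (g s) (p s)"]
      by (simp add: contour_integral_unique)
  qed
  have ab01: "a \<in> {0..1}" "b \<in> {0..1}" using ab by auto
  have "contour_integral (subpath a b p) f = F (p b) - F (p a)"
  proof -
    have "path_image (subpath a b p) \<subseteq> ball (g t) e"
      using pin ab by (auto simp: path_image_subpath)
    then show ?thesis
      using contour_integral_primitive[OF F, where g = "subpath a b p"] valid_path_subpath[OF p(1) ab01]
      by (simp add: contour_integral_unique subpath_def pathstart_def pathfinish_def)
  qed
  moreover have "contour_integral (subpath 0 a p) f + contour_integral (subpath a b p) f
      = contour_integral (subpath 0 b p) f"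
    using ab01 by (intro contour_integral_subpath_combine int p) auto
  ultimately have sub: "contour_integral (subpath 0 b p) f
      = contour_integral (subpath 0 a p) f + (F (p b) - F (p a))" by simp
  have La: "contour_integral (linepath (g a) (p a)) f = F (p a) - F (g a)"
    and Lb: "contour_integral (linepath (g b) (p b)) f = F (p b) - F (g b)" using L ab by auto
  show "\<Phi> b - \<Phi> a = F (g b) - F (g a)"
    unfolding \<Phi>_def sub La Lb by simp
qed

text \<open>Rectifiability bounds sums over plain divisions.  Forgetting tags could merge only degenerate
  intervals, and those contribute nothing.\<close>
lemma rectifiable_path_tagged_bound:
  assumes "rectifiable_path g"
  obtains B where "B > 0" "\<And>p. p tagged_division_of {0..1} \<Longrightarrow>
     (\<Sum>(t, K)\<in>p. norm (g (Sup K) - g (Inf K))) \<le> B"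
proof -
  obtain B where B: "\<And>p. p division_of {0..1} \<Longrightarrow> (\<Sum>K\<in>p. norm (g (Sup K) - g (Inf K))) \<le> B"
    using assms unfolding rectifiable_path_def by blast
  show ?thesis
  proof
    show "max B 1 > 0" by simp
    fix p :: "(real \<times> real set) set" assume p: "p tagged_division_of {0..1}"
    have nonempty: "(t, {}) \<notin> p" for t
      using tagged_division_ofD(2)[OF p, of t "{}"] by blast
    let ?d = "\<lambda>K. if K = {} then 0 else norm (g (Sup K) - g (Inf K))"
    have "(\<Sum>(t, K)\<in>p. norm (g (Sup K) - g (Inf K))) = (\<Sum>(t, K)\<in>p. ?d K)"
      using nonempty by (intro sum.cong) auto
    also have "\<dots> = (\<Sum>K\<in>snd ` p. ?d K)"
    proof (rule sum.over_tagged_division_lemma[OF p])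
      fix u v :: real assume "box u v = {}"
      then have "v \<le> u" by simp
      then show "?d (cbox u v) = 0"
        by (cases "u = v") auto
    qed
    also have "\<dots> = (\<Sum>K\<in>snd ` p. norm (g (Sup K) - g (Inf K)))"
      using nonempty by (intro sum.cong) auto
    also have "\<dots> \<le> B" using B division_of_tagged_division[OF p] by blast
    finally show "(\<Sum>(t, K)\<in>p. norm (g (Sup K) - g (Inf K))) \<le> max B 1" by simp
  qed
qed

text \<open>A fixed mesh size is required of Riemann-Stieltjes sums, so the oscillation of \<open>f\<close> has to be controlled
  uniformly along the whole curve, on a compact tube around it.\<close>
lemma uniform_modulus_near_path:
  fixes g :: "real \<Rightarrow> complex"
  assumes "path g" "continuous_on S f" "e > 0" "\<eta> > 0"
    and balls: "\<And>t. t \<in> {0..1} \<Longrightarrow> ball (g t) e \<subseteq> S"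
  obtains d where "d > 0" "d \<le> e"
    "\<And>t z. t \<in> {0..1} \<Longrightarrow> z \<in> ball (g t) d \<Longrightarrow> norm (f z - f (g t)) \<le> \<eta>"
proof -
  define K where "K = {x + y |x y. x \<in> path_image g \<and> y \<in> cball 0 (e/2)}"
  have "compact K" unfolding K_def
    by (rule compact_sums) (auto simp: compact_path_image assms)
  moreover have "K \<subseteq> S"
  proof
    fix z assume "z \<in> K"
    then obtain t y where t: "t \<in> {0..1}" "z = g t + y" "norm y \<le> e/2"
      by (auto simp: K_def path_image_def)
    then have "z \<in> ball (g t) e" using \<open>e > 0\<close> by (simp add: dist_norm)
    then show "z \<in> S" using balls t by blast
  qed
  ultimately have "uniformly_continuous_on K f"
    using assms(2) compact_uniformly_continuous continuous_on_subset by blast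
  then obtain d where d: "d > 0" "\<And>x y. x \<in> K \<Longrightarrow> y \<in> K \<Longrightarrow> dist y x < d \<Longrightarrow> dist (f y) (f x) < \<eta>"
    using \<open>\<eta> > 0\<close> unfolding uniformly_continuous_on_def by metis
  show ?thesis
  proof
    show "min d (e/2) > 0" "min d (e/2) \<le> e" using d(1) \<open>e > 0\<close> by auto
    fix t z assume t: "t \<in> {0..1::real}" and z: "z \<in> ball (g t) (min d (e/2))"
    have "z = g t + (z - g t)" "z - g t \<in> cball 0 (e/2)"
      using z by (auto simp: dist_norm norm_minus_commute)
    then have "z \<in> K" using t unfolding K_def path_image_def by blast
    moreover have "g t = g t + 0" "(0::complex) \<in> cball 0 (e/2)" using \<open>e > 0\<close> by auto
    then have "g t \<in> K" using t unfolding K_def path_image_def by blast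
    ultimately have "dist (f z) (f (g t)) < \<eta>"
      using d(2) z by (simp add: dist_commute)
    then show "norm (f z - f (g t)) \<le> \<eta>" by (simp add: dist_norm)
  qed
qed

text \<open>On a short piece of the curve a Riemann-Stieltjes summand differs from the increase of a primitive
  by at most \<open>\<eta>\<close> times the chord.  The increases telescope to the integral along \<open>p\<close>, and the
  chords add up to at most the length of \<open>g\<close>.\<close>
lemma has_curve_integral_contour_integral:
  fixes g p :: "real \<Rightarrow> complex"
  assumes g: "rectifiable_path g" and S: "open S" "f holomorphic_on S" and e: "e > 0"
    and balls: "\<And>t. t \<in> {0..1} \<Longrightarrow> ball (g t) e \<subseteq> S"
    and p: "valid_path p" "pathstart p = pathstart g" "pathfinish p = pathfinish g"
    and near: "\<And>t. t \<in> {0..1} \<Longrightarrow> norm (p t - g t) < e / 2"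
  shows "has_curve_integral f (contour_integral p f) g"
  unfolding has_curve_integral_def
proof (intro allI impI)
  fix \<epsilon> :: real assume \<epsilon>: "\<epsilon> > 0"
  have pg: "path g" using g by (simp add: rectifiable_path_def)
  have contf: "continuous_on S f" using S(2) holomorphic_on_imp_continuous_on by blast
  obtain \<Phi> where \<Phi>1: "\<Phi> (1::real) - \<Phi> 0 = contour_integral p f"
    and \<Phi>: "\<And>t F a b. t \<in> {0..1} \<Longrightarrow>
       (\<And>z. z \<in> ball (g t) e \<Longrightarrow> (F has_field_derivative f z) (at z within ball (g t) e)) \<Longrightarrow>
       0 \<le> a \<Longrightarrow> a \<le> b \<Longrightarrow> b \<le> 1 \<Longrightarrow> (\<And>s. s \<in> {a..b} \<Longrightarrow> norm (g s - g t) < e / 2) \<Longrightarrow>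
       \<Phi> b - \<Phi> a = F (g b) - F (g a)"
    using primitive_along_path[OF S e balls p near] by metis
  obtain B where B: "B > 0" "\<And>p. p tagged_division_of {0..1} \<Longrightarrow>
     (\<Sum>(t, K)\<in>p. norm (g (Sup K) - g (Inf K))) \<le> B"
    using rectifiable_path_tagged_bound[OF g] by blast
  define \<eta> where "\<eta> = \<epsilon> / (2 * B)"
  have \<eta>: "\<eta> > 0" using \<epsilon> B(1) by (simp add: \<eta>_def)
  obtain d where d: "d > 0" "d \<le> e"
    "\<And>t z. t \<in> {0..1} \<Longrightarrow> z \<in> ball (g t) d \<Longrightarrow> norm (f z - f (g t)) \<le> \<eta>"
    using uniform_modulus_near_path[OF pg contf e \<eta> balls] by blast
  have "uniformly_continuous_on {0..1} g"
    using pg by (simp add: path_def compact_uniformly_continuous)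
  moreover have "min d (e/2) > 0" using d e by simp
  ultimately obtain \<delta> where \<delta>: "\<delta> > 0"
    "\<And>s t. s \<in> {0..1} \<Longrightarrow> t \<in> {0..1} \<Longrightarrow> dist s t < \<delta> \<Longrightarrow> dist (g s) (g t) < min d (e/2)"
    unfolding uniformly_continuous_on_def by metis
  show "\<exists>\<delta>>0. \<forall>q. q tagged_division_of {0..1} \<and> (\<lambda>t. ball t \<delta>) fine q \<longrightarrow>
        norm ((\<Sum>(t, K)\<in>q. f (g t) * (g (Sup K) - g (Inf K))) - contour_integral p f) < \<epsilon>"
  proof (intro exI conjI allI impI)
    show "\<delta> > 0" by fact
    fix q assume "q tagged_division_of {0..1::real} \<and> (\<lambda>t. ball t \<delta>) fine q"
    then have q: "q tagged_division_of {0..1}" and fine: "(\<lambda>t. ball t \<delta>) fine q" by auto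
    have piece: "norm (f (g t) * (g (Sup K) - g (Inf K)) - (\<Phi> (Sup K) - \<Phi> (Inf K)))
        \<le> \<eta> * norm (g (Sup K) - g (Inf K))" if tK: "(t, K) \<in> q" for t K
    proof -
      obtain a b where ab: "K = cbox a b" using tagged_division_ofD(4)[OF q tK] by blast
      have tin: "t \<in> K" and K01: "K \<subseteq> {0..1}" using tagged_division_ofD(2,3)[OF q tK] by auto
      have le: "a \<le> b" and K: "K = {a..b}" using tin ab by (auto simp: box_real)
      have SI: "Sup K = b" "Inf K = a" using le K by auto
      have t01: "t \<in> {0..1}" using tin K01 by blast
      have ab01: "0 \<le> a" "b \<le> 1" using K01 K le by auto
      have close: "norm (g s - g t) < min d (e/2)" if "s \<in> {a..b}" for s
      proof -
        have "s \<in> ball t \<delta>" using fineD[OF fine tK] that K by blast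
        then have "dist t s < \<delta>" by simp
        then show ?thesis using \<delta>(2)[of s t] t01 that K K01 by (auto simp: dist_commute dist_norm)
      qed
      have "f holomorphic_on ball (g t) e"
        using S(2) balls[OF t01] holomorphic_on_subset by blast
      then obtain F where F: "\<And>z. z \<in> ball (g t) e \<Longrightarrow>
          (F has_field_derivative f z) (at z within ball (g t) e)"
        using holomorphic_convex_primitive'[OF convex_ball open_ball] by blast
      have 1: "\<Phi> b - \<Phi> a = F (g b) - F (g a)"
        using close by (intro \<Phi>[OF t01 F] ab01 le) auto
      have "norm ((F (g b) - f (g t) * g b) - (F (g a) - f (g t) * g a)) \<le> \<eta> * norm (g b - g a)"
      proof (rule field_differentiable_bound[where S = "ball (g t) d" and f' = "\<lambda>z. f z - f (g t)"])
        show "((\<lambda>z. F z - f (g t) * z) has_field_derivative f z - f (g t)) (at z within ball (g t) d)"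
          if "z \<in> ball (g t) d" for z
        proof -
          have "(F has_field_derivative f z) (at z within ball (g t) d)"
            using F[of z] that d(2) by (meson DERIV_subset subset_ball subsetD)
          then show ?thesis by (auto intro!: derivative_eq_intros)
        qed
        show "norm (f z - f (g t)) \<le> \<eta>" if "z \<in> ball (g t) d" for z using d(3)[OF t01 that] .
        show "g b \<in> ball (g t) d" "g a \<in> ball (g t) d"
          using close[of a] close[of b] le by (auto simp: dist_norm norm_minus_commute)
      qed auto
      moreover have "f (g t) * (g b - g a) - (\<Phi> b - \<Phi> a)
         = - ((F (g b) - f (g t) * g b) - (F (g a) - f (g t) * g a))"
        unfolding 1 by (simp add: algebra_simps)
      ultimately show ?thesis unfolding SI by (simp only: norm_minus_cancel)
    qed
    have "(\<Sum>(t, K)\<in>q. f (g t) * (g (Sup K) - g (Inf K))) - contour_integral p f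
       = (\<Sum>(t, K)\<in>q. f (g t) * (g (Sup K) - g (Inf K)) - (\<Phi> (Sup K) - \<Phi> (Inf K)))"
      using additive_tagged_division_1[OF _ q, of \<Phi>] \<Phi>1
      by (simp add: sum_subtractf case_prod_unfold)
    also have "norm \<dots> \<le> (\<Sum>(t, K)\<in>q. \<eta> * norm (g (Sup K) - g (Inf K)))"
      by (rule sum_norm_le) (use piece in auto)
    also have "\<dots> = \<eta> * (\<Sum>(t, K)\<in>q. norm (g (Sup K) - g (Inf K)))"
      by (simp add: sum_distrib_left case_prod_unfold)
    also have "\<dots> \<le> \<eta> * B" using B(2)[OF q] \<eta> by simp
    also have "\<dots> < \<epsilon>" using \<epsilon> B(1) by (simp add: \<eta>_def)
    finally show "norm ((\<Sum>(t, K)\<in>q. f (g t) * (g (Sup K) - g (Inf K))) - contour_integral p f) < \<epsilon>" .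
  qed
qed

text \<open>The single path \<open>p\<close> serves all integrands holomorphic on \<open>S\<close> and has the winding numbers of \<open>g\<close> about
  the complement of \<open>S\<close>.  Every theorem on contour integrals along valid paths thereby becomes
  applicable to the rectifiable curve \<open>g\<close>.\<close>
lemma curve_integral_homologous_path:
  assumes g: "rectifiable_path g" "pathfinish g = pathstart g"
    and S: "open S" "path_image g \<subseteq> S"
  obtains p where "valid_path p" "pathfinish p = pathstart p" "path_image p \<subseteq> S"
    "\<And>z. z \<notin> S \<Longrightarrow> winding_number p z = winding_number g z"
    "\<And>f. f holomorphic_on S \<Longrightarrow> has_curve_integral f (contour_integral p f) g"
proof -
  have pg: "path g" using g by (simp add: rectifiable_path_def)
  obtain e where e: "e > 0" "\<And>x. x \<in> path_image g \<Longrightarrow> ball x e \<subseteq> S"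
  proof -
    obtain e where "e > 0" "(\<Union>x\<in>path_image g. ball x e) \<subseteq> S"
      using compact_subset_open_imp_ball_epsilon_subset[OF compact_path_image[OF pg] S(1,2)] by blast
    then show ?thesis using that by blast
  qed
  have balls: "ball (g t) e \<subseteq> S" if "t \<in> {0..1}" for t using e(2) that by (auto simp: path_image_def)
  obtain p where p: "polynomial_function p" "pathstart p = pathstart g" "pathfinish p = pathfinish g"
     "\<And>t. t \<in> {0..1} \<Longrightarrow> norm(p t - g t) < e/2"
    using path_approx_polynomial_function[OF pg, of "e/2"] e(1) by auto
  have vp: "valid_path p" using p(1) by (rule valid_path_polynomial_function)
  have hom: "homotopic_loops S g p"
  proof (rule homotopic_loops_nearby_explicit)
    fix t x assume t: "t \<in> {0..1::real}" "x \<notin> S"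
    then have "x \<notin> ball (g t) e" using balls by blast
    then show "norm (p t - g t) < norm (g t - x)" using p(4)[OF t(1)] e(1) by (simp add: dist_norm)
  qed (use p vp pg g valid_path_imp_path in auto)
  show ?thesis
  proof
    show "valid_path p" by fact
    show "pathfinish p = pathstart p" using p g by simp
    show "path_image p \<subseteq> S" using homotopic_loops_imp_subset[OF hom] by simp
    show "winding_number p z = winding_number g z" if "z \<notin> S" for z
    proof -
      have "homotopic_loops (-{z}) g p" using homotopic_loops_subset[OF hom] that by auto
      then show ?thesis by (simp add: winding_number_homotopic_loops)
    qed
    show "has_curve_integral f (contour_integral p f) g" if "f holomorphic_on S" for f
      using has_curve_integral_contour_integral[OF g(1) S(1) that e(1) balls vp p(2,3,4)] .
  qed
qed


section \<open>Orthogonal projections and the largest principal angle\<close>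

lemma inner_eq_Re_cinner: "inner x y = Re (cinner x y)"
  by (simp add: cinner_def inner_vec_def inner_complex_def)

lemma cinner_scale_left: "cinner (c *s z) v = cnj c * cinner z v"
  by (simp add: cinner_def sum_distrib_left mult.assoc)

lemma cinner_scale_right: "cinner z (c *s v) = c * cinner z v"
  by (simp add: cinner_def sum_distrib_left mult.left_commute)

lemma scaleR_eq_vec_scale: "r *\<^sub>R x = of_real r *s (x :: complex ^ 'n)"
  by (simp only: vec_eq_iff vector_scaleR_component vector_smult_component) (simp add: scaleR_conv_of_real)

lemma norm_vec_scale: "norm (c *s (x :: complex ^ 'n)) = cmod c * norm x"
  by (simp add: norm_vec_def L2_set_def norm_mult power_mult_distrib
      real_sqrt_mult flip: sum_distrib_left)

lemma subspace_if_vec_subspace: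
  fixes Y :: "(complex ^ 'n) set"
  assumes "vec.subspace Y"
  shows "subspace Y"
  using assms unfolding vec.subspace_def subspace_def by (simp add: scaleR_eq_vec_scale)

text \<open>A complex subspace is closed under multiplication by the imaginary unit, so orthogonality to it for the
  real inner product is the same as for the Hermitian one; projections can then be taken over the reals.\<close>
lemma orthogonal_iff_cinner:
  assumes "vec.subspace Y"
  shows "(\<forall>z\<in>Y. inner v z = 0) \<longleftrightarrow> (\<forall>z\<in>Y. cinner z v = 0)"
proof
  assume *: "\<forall>z\<in>Y. inner v z = 0"
  show "\<forall>z\<in>Y. cinner z v = 0"
  proof
    fix z assume "z \<in> Y"
    then have "cinner z v *s z \<in> Y" using assms by (simp add: vec.subspace_scale)
    then have "inner (cinner z v *s z) v = 0" using * inner_commute by metis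
    then have "Re (cnj (cinner z v) * cinner z v) = 0"
      by (simp add: inner_eq_Re_cinner cinner_scale_left)
    then show "cinner z v = 0" by (simp add: complex_eq_iff flip: power2_eq_square)
  qed
qed (metis inner_commute inner_eq_Re_cinner zero_complex.sel(1))

definition orth_proj :: "(complex ^ 'n) set \<Rightarrow> complex ^ 'n \<Rightarrow> complex ^ 'n" where
  "orth_proj Y x = (SOME y. y \<in> Y \<and> (\<forall>z\<in>Y. inner (x - y) z = 0))"

lemma orth_proj:
  assumes "vec.subspace Y"
  shows orth_proj_mem: "orth_proj Y x \<in> Y"
    and orth_proj_orth: "z \<in> Y \<Longrightarrow> inner (x - orth_proj Y x) z = 0"
proof -
  have sp: "span Y = Y" using subspace_if_vec_subspace[OF assms] by (simp add: span_eq_iff)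
  obtain y r where "y \<in> span Y" "\<And>w. w \<in> span Y \<Longrightarrow> orthogonal r w" "x = y + r"
    using orthogonal_subspace_decomp_exists[of Y x] by metis
  then have "y \<in> Y \<and> (\<forall>z\<in>Y. inner (x - y) z = 0)" by (simp add: sp orthogonal_def)
  then have "orth_proj Y x \<in> Y \<and> (\<forall>z\<in>Y. inner (x - orth_proj Y x) z = 0)"
    unfolding orth_proj_def by (rule someI)
  then show "orth_proj Y x \<in> Y" "z \<in> Y \<Longrightarrow> inner (x - orth_proj Y x) z = 0" by auto
qed

lemma orth_proj_unique:
  assumes "vec.subspace Y" "y \<in> Y" "\<And>z. z \<in> Y \<Longrightarrow> inner (x - y) z = 0"
  shows "orth_proj Y x = y"
proof -
  let ?d = "orth_proj Y x - y"
  have d: "?d \<in> Y" using assms(1,2) orth_proj_mem[OF assms(1)] by (simp add: vec.subspace_diff)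
  have "inner ?d ?d = inner (x - y) ?d - inner (x - orth_proj Y x) ?d"
    by (simp add: inner_diff_left)
  also have "\<dots> = 0" using assms(3)[OF d] orth_proj_orth[OF assms(1) d] by simp
  finally show ?thesis by simp
qed

lemma linear_orth_proj:
  assumes "vec.subspace Y"
  shows "Vector_Spaces.linear (*s) (*s) (orth_proj Y)"
proof -
  note orth = orth_proj_orth[OF assms] and mem = orth_proj_mem[OF assms]
  have "orth_proj Y (x + y) = orth_proj Y x + orth_proj Y y" for x y
  proof (rule orth_proj_unique[OF assms])
    show "orth_proj Y x + orth_proj Y y \<in> Y" using mem assms by (simp add: vec.subspace_add)
    show "inner (x + y - (orth_proj Y x + orth_proj Y y)) z = 0" if "z \<in> Y" for z
      using orth[OF that, of x] orth[OF that, of y] by (simp add: inner_diff_left inner_add_left)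
  qed
  moreover have "orth_proj Y (c *s x) = c *s orth_proj Y x" for c x
  proof (rule orth_proj_unique[OF assms])
    show "c *s orth_proj Y x \<in> Y" using mem assms by (simp add: vec.subspace_scale)
    have "\<forall>z\<in>Y. cinner z (x - orth_proj Y x) = 0"
      using orth orthogonal_iff_cinner[OF assms] by blast
    then have "\<forall>z\<in>Y. cinner z (c *s (x - orth_proj Y x)) = 0"
      by (simp only: cinner_scale_right) simp
    then have "\<forall>z\<in>Y. inner (c *s (x - orth_proj Y x)) z = 0"
      using orthogonal_iff_cinner[OF assms] by blast
    then show "inner (c *s x - c *s orth_proj Y x) z = 0" if "z \<in> Y" for z
      using that by (simp add: vec.scale_right_diff_distrib)
  qed
  ultimately show ?thesis by unfold_locales auto
qed

lemma bounded_linear_orth_proj: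
  assumes "vec.subspace Y"
  shows "bounded_linear (orth_proj Y)"
proof -
  interpret l: Vector_Spaces.linear "(*s)" "(*s)" "orth_proj Y" using linear_orth_proj[OF assms] .
  have "linear (orth_proj Y)"
    by (rule linearI) (simp_all add: l.add l.scale scaleR_eq_vec_scale)
  then show ?thesis by (simp add: linear_conv_bounded_linear)
qed

lemma norm_orth_proj_pythagoras:
  assumes "vec.subspace Y"
  shows "(norm x)\<^sup>2 = (norm (orth_proj Y x))\<^sup>2 + (norm (x - orth_proj Y x))\<^sup>2"
proof -
  have "inner (x - orth_proj Y x) (orth_proj Y x) = 0"
    using orth_proj_orth orth_proj_mem assms by blast
  then show ?thesis
    by (simp add: power2_norm_eq_inner inner_diff_left inner_diff_right inner_commute)
qed

lemma inner_orth_proj: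
  assumes "vec.subspace Y" "y \<in> Y"
  shows "inner (orth_proj Y x) y = inner x y"
  using orth_proj_orth[OF assms, of x] by (simp add: inner_diff_left)

lemma norm_residual_le:
  assumes "vec.subspace Y" "y \<in> Y"
  shows "norm (x - orth_proj Y x) \<le> norm (x - y)"
proof -
  have o: "inner (x - orth_proj Y x) (orth_proj Y x - y) = 0"
    using assms orth_proj_orth orth_proj_mem vec.subspace_diff by blast
  have "(norm ((x - orth_proj Y x) + (orth_proj Y x - y)))\<^sup>2
      = (norm (x - orth_proj Y x))\<^sup>2 + (norm (orth_proj Y x - y))\<^sup>2"
    using o unfolding power2_norm_eq_inner inner_add_left inner_add_right
    by (simp add: inner_commute[of "orth_proj Y x - y" "x - orth_proj Y x"])
  moreover have "(x - orth_proj Y x) + (orth_proj Y x - y) = x - y" by simp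
  ultimately have "(norm (x - orth_proj Y x))\<^sup>2 \<le> (norm (x - y))\<^sup>2" by simp
  then show ?thesis by (rule power2_le_imp_le) simp
qed

lemma principal_angle_iff_inner:
  assumes "vec.subspace X" "vec.subspace Y"
  shows "principal_angle X Y \<theta> \<longleftrightarrow> 0 \<le> \<theta> \<and> \<theta> \<le> pi / 2 \<and>
     (\<exists>x\<in>X. \<exists>y\<in>Y. norm x = 1 \<and> norm y = 1 \<and>
        (\<forall>z\<in>X. inner (y - cos \<theta> *\<^sub>R x) z = 0) \<and>
        (\<forall>z\<in>Y. inner (x - cos \<theta> *\<^sub>R y) z = 0))"
  unfolding principal_angle_def scaleR_eq_vec_scale
  by (simp only: orthogonal_iff_cinner[OF assms(1)] orthogonal_iff_cinner[OF assms(2)])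

lemma subspace_angle_commute: "subspace_angle X Y = subspace_angle Y X"
proof -
  have "principal_angle X Y = principal_angle Y X"
    unfolding principal_angle_def fun_eq_iff by blast
  then show ?thesis by (simp add: subspace_angle_def)
qed

text \<open>This provides the second vector for a principal angle of \<open>pi / 2\<close>.  If projection onto \<open>X\<close> were
  injective on \<open>Y\<close>, it would be onto \<open>X\<close> by equality of dimensions, and \<open>x\<close>, being orthogonal to
  \<open>Y\<close>, would be orthogonal to itself.\<close>
lemma orthogonal_vector_if_proj_kernel:
  fixes X Y :: "(complex ^ 'n) set"
  assumes X: "vec.subspace X" and Y: "vec.subspace Y" and dim: "vec.dim X = vec.dim Y"
    and x: "x \<in> X" "x \<noteq> 0" "orth_proj Y x = 0"
  obtains y where "y \<in> Y" "norm y = 1" "orth_proj X y = 0"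
proof -
  interpret l: Vector_Spaces.linear "(*s)" "(*s)" "orth_proj X" using linear_orth_proj[OF X] .
  have "\<exists>y\<in>Y. y \<noteq> 0 \<and> orth_proj X y = 0"
  proof (rule ccontr)
    assume no: "\<not> (\<exists>y\<in>Y. y \<noteq> 0 \<and> orth_proj X y = 0)"
    have "inj_on (orth_proj X) Y"
    proof (rule inj_onI)
      fix a b assume ab: "a \<in> Y" "b \<in> Y" "orth_proj X a = orth_proj X b"
      then have "a - b \<in> Y" "orth_proj X (a - b) = 0"
        using Y by (simp_all add: vec.subspace_diff l.diff)
      then show "a = b" using no by auto
    qed
    then have "vec.dim (orth_proj X ` Y) = vec.dim Y"
      by (intro vec.dim_image_eq linear_orth_proj[OF X]) (simp only: iffD2[OF vec.span_eq_iff Y])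
    moreover have "orth_proj X ` Y \<subseteq> X" using orth_proj_mem[OF X] by blast
    moreover have "vec.subspace (orth_proj X ` Y)" using Y by (rule l.subspace_image)
    ultimately have "orth_proj X ` Y = X"
      using X dim by (intro vec.subspace_dim_equal) auto
    then obtain y where y: "y \<in> Y" "x = orth_proj X y" using x(1) by blast
    have "inner x x = inner y x" using inner_orth_proj[OF X x(1), of y] y(2) by simp
    also have "\<dots> = inner (orth_proj Y x) y"
      using inner_orth_proj[OF Y y(1), of x] by (simp add: inner_commute)
    finally have "inner x x = 0" using x(3) by simp
    then show False using x(2) by simp
  qed
  then obtain y where y: "y \<in> Y" "y \<noteq> 0" "orth_proj X y = 0" by blast
  show ?thesis
  proof
    let ?c = "of_real (1 / norm y) :: complex"
    show "?c *s y \<in> Y" using y Y by (simp add: vec.subspace_scale)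
    show "norm (?c *s y) = 1" using y by (simp add: norm_vec_scale norm_divide)
    show "orth_proj X (?c *s y) = 0" using y by (simp add: l.scale)
  qed
qed

lemma norm_add_scaleR_square:
  fixes x z :: "'a::real_inner"
  shows "(norm (x + t *\<^sub>R z))\<^sup>2 = (norm x)\<^sup>2 + 2 * t * inner x z + t\<^sup>2 * (norm z)\<^sup>2"
  unfolding power2_norm_eq_inner inner_add_left inner_add_right
  by (simp add: inner_commute[of z x] power2_eq_square)

text \<open>A unit vector of \<open>X\<close> with shortest projection onto \<open>Y\<close> is critical for the Rayleigh quotient of that
  projection, and the critical point equation says that it forms a principal pair with its normalised projection;
  if that projection is zero, any unit vector of \<open>Y\<close> orthogonal to \<open>X\<close> is a partner.
  Minimality bounds the residuals of all vectors of \<open>X\<close>.\<close>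
lemma ex_largest_principal_angle:
  fixes X Y :: "(complex ^ 'n) set"
  assumes X: "vec.subspace X" and Y: "vec.subspace Y" and dim: "vec.dim X = vec.dim Y"
    and pos: "vec.dim X > 0"
  obtains \<theta> where "principal_angle X Y \<theta>"
    "\<And>x. x \<in> X \<Longrightarrow> norm (x - orth_proj Y x) \<le> sin \<theta> * norm x"
proof -
  interpret l: Vector_Spaces.linear "(*s)" "(*s)" "orth_proj Y" using linear_orth_proj[OF Y] .
  have sX: "subspace X" using subspace_if_vec_subspace[OF X] .
  obtain v where v: "v \<in> X" "v \<noteq> 0" using pos by (metis vec.dim_eq_0 gr0_implies_Suc nat.simps(3) singletonI subsetI)
  have "of_real (1 / norm v) *s v \<in> X \<inter> sphere 0 1"
    using v X by (simp add: vec.subspace_scale norm_vec_scale norm_divide)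
  then have ne: "X \<inter> sphere 0 1 \<noteq> {}" by blast
  have comp: "compact (X \<inter> sphere 0 1)"
    using closed_subspace[OF sX] by (simp add: closed_Int_compact)
  have "continuous_on (X \<inter> sphere 0 1) (\<lambda>x. norm (orth_proj Y x))"
    by (intro continuous_on_norm linear_continuous_on bounded_linear_orth_proj Y)
  then obtain x0 where x0: "x0 \<in> X \<inter> sphere 0 1"
    and min: "\<And>x. x \<in> X \<inter> sphere 0 1 \<Longrightarrow> norm (orth_proj Y x0) \<le> norm (orth_proj Y x)"
    using continuous_attains_inf[OF comp ne] by blast
  define c where "c = norm (orth_proj Y x0)"
  have x0X: "x0 \<in> X" and x0n: "norm x0 = 1" using x0 by auto
  have lower: "c * norm x \<le> norm (orth_proj Y x)" if "x \<in> X" for x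
  proof (cases "x = 0")
    case False
    let ?a = "of_real (1 / norm x) :: complex"
    have "?a *s x \<in> X \<inter> sphere 0 1"
      using that False X by (simp add: vec.subspace_scale norm_vec_scale norm_divide)
    then have "c \<le> norm (orth_proj Y (?a *s x))" unfolding c_def by (rule min)
    also have "\<dots> = norm (orth_proj Y x) / norm x"
      by (simp add: l.scale norm_vec_scale norm_divide)
    finally show ?thesis using False by (simp add: field_simps)
  qed simp
  have "c\<^sup>2 \<le> 1\<^sup>2"
    using norm_orth_proj_pythagoras[OF Y, of x0] x0n unfolding c_def
    by (metis le_add_same_cancel1 zero_le_power2)
  then have c: "0 \<le> c" "c \<le> 1"
    by (auto simp: c_def intro: power2_le_imp_le)
  define \<theta> where "\<theta> = arccos c"
  have cos: "cos \<theta> = c" using c by (simp add: \<theta>_def)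
  have \<theta>: "0 \<le> \<theta>" "\<theta> \<le> pi / 2" using arccos_le_pi2[OF c] arccos_lbound[of c] c by (simp_all add: \<theta>_def)
  \<comment> \<open>First variation of the nonnegative form \<open>|P x|\<^sup>2 - c\<^sup>2 |x|\<^sup>2\<close>, which vanishes at \<open>x0\<close>.\<close>
  have crit: "inner (orth_proj Y x0 - c\<^sup>2 *\<^sub>R x0) z = 0" if z: "z \<in> X" for z
  proof -
    define b where "b = inner (orth_proj Y x0 - c\<^sup>2 *\<^sub>R x0) z"
    define q where "q = (norm (orth_proj Y z))\<^sup>2 - c\<^sup>2 * (norm z)\<^sup>2"
    have nonneg: "0 \<le> 2 * t * b + t\<^sup>2 * q" for t
    proof -
      have "x0 + t *\<^sub>R z \<in> X" using sX x0X z by (simp add: subspace_add subspace_scale)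
      then have "(c * norm (x0 + t *\<^sub>R z))\<^sup>2 \<le> (norm (orth_proj Y (x0 + t *\<^sub>R z)))\<^sup>2"
        using lower c by (intro power_mono) auto
      also have "orth_proj Y (x0 + t *\<^sub>R z) = orth_proj Y x0 + t *\<^sub>R orth_proj Y z"
        by (simp add: scaleR_eq_vec_scale l.add l.scale)
      finally have "c\<^sup>2 * (1 + 2 * t * inner x0 z + t\<^sup>2 * (norm z)\<^sup>2)
          \<le> c\<^sup>2 + 2 * t * inner (orth_proj Y x0) (orth_proj Y z) + t\<^sup>2 * (norm (orth_proj Y z))\<^sup>2"
        unfolding power_mult_distrib norm_add_scaleR_square by (simp add: x0n c_def)
      moreover have "inner (orth_proj Y x0) (orth_proj Y z) = inner (orth_proj Y x0) z"
        using inner_orth_proj[OF Y orth_proj_mem[OF Y], of z x0] by (simp add: inner_commute)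
      ultimately show ?thesis
        by (simp add: b_def q_def inner_diff_left algebra_simps)
    qed
    have "b = 0"
    proof (rule ccontr)
      assume "b \<noteq> 0"
      define s where "s = 1 + \<bar>q\<bar>"
      have s: "s > 0" "q \<le> s" by (auto simp: s_def)
      \<comment> \<open>This \<open>t\<close> makes the linear term beat the quadratic one.\<close>
      define t where "t = - b / s"
      have "2 * t * b + t\<^sup>2 * q \<le> 2 * t * b + t\<^sup>2 * s"
        using s by (intro add_left_mono mult_left_mono) auto
      also have "\<dots> = - b\<^sup>2 / s"
        using s by (simp add: t_def field_simps power2_eq_square)
      also have "\<dots> < 0" using \<open>b \<noteq> 0\<close> s by (simp add: divide_neg_pos)
      finally show False using nonneg[of t] by simp
    qed
    then show ?thesis by (simp add: b_def)
  qed
  have "principal_angle X Y \<theta>"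
  proof (cases "c = 0")
    case True
    then have P0: "orth_proj Y x0 = 0" by (simp add: c_def)
    have "x0 \<noteq> 0" using x0n by auto
    then obtain y where y: "y \<in> Y" "norm y = 1" "orth_proj X y = 0"
      using orthogonal_vector_if_proj_kernel[OF X Y dim x0X _ P0] by metis
    have "\<forall>z\<in>X. inner (y - c *\<^sub>R x0) z = 0"
      using orth_proj_orth[OF X, of _ y] y(3) True by simp
    moreover have "\<forall>z\<in>Y. inner (x0 - c *\<^sub>R y) z = 0"
      using orth_proj_orth[OF Y, of _ x0] P0 True by simp
    ultimately show ?thesis
      unfolding principal_angle_iff_inner[OF X Y] cos using \<theta> x0X x0n y(1,2) by blast
  next
    case False
    define y where "y = (1 / c) *\<^sub>R orth_proj Y x0"
    have py: "orth_proj Y x0 = c *\<^sub>R y" using False by (simp add: y_def)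
    have "y \<in> Y" unfolding y_def
      using subspace_scale[OF subspace_if_vec_subspace[OF Y]] orth_proj_mem[OF Y] by blast
    moreover have "norm y = 1" using False c by (simp add: y_def c_def[symmetric])
    moreover have "inner (y - c *\<^sub>R x0) z = 0" if "z \<in> X" for z
    proof -
      have "c * inner (y - c *\<^sub>R x0) z = 0" using crit[OF that] unfolding py
        by (simp add: inner_diff_left right_diff_distrib power2_eq_square)
      then show ?thesis using False by simp
    qed
    moreover have "inner (x0 - c *\<^sub>R y) z = 0" if "z \<in> Y" for z
      using orth_proj_orth[OF Y that, of x0] unfolding py .
    ultimately show ?thesis
      unfolding principal_angle_iff_inner[OF X Y] cos using \<theta> x0X x0n by blast
  qed
  moreover have "norm (x - orth_proj Y x) \<le> sin \<theta> * norm x" if "x \<in> X" for x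
  proof (rule power2_le_imp_le)
    have "(c * norm x)\<^sup>2 \<le> (norm (orth_proj Y x))\<^sup>2" using lower[OF that] c by (intro power_mono) auto
    then have "(norm (x - orth_proj Y x))\<^sup>2 \<le> (1 - (cos \<theta>)\<^sup>2) * (norm x)\<^sup>2"
      using norm_orth_proj_pythagoras[OF Y, of x] by (simp add: cos power_mult_distrib algebra_simps)
    then show "(norm (x - orth_proj Y x))\<^sup>2 \<le> (sin \<theta> * norm x)\<^sup>2"
      by (simp add: power_mult_distrib sin_squared_eq)
    show "0 \<le> sin \<theta> * norm x" using \<theta> by (intro mult_nonneg_nonneg sin_ge_zero) auto
  qed
  ultimately show ?thesis using that by blast
qed

text \<open>The sharp bound has the sine of the angle; the angle itself is enough here and avoids
  monotonicity of the sine.\<close>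
lemma residual_le_subspace_angle:
  fixes X Y :: "(complex ^ 'n) set"
  assumes X: "vec.subspace X" and Y: "vec.subspace Y" and dim: "vec.dim X = vec.dim Y"
    and x: "x \<in> X"
  shows "norm (x - orth_proj Y x) \<le> subspace_angle X Y * norm x"
proof (cases "vec.dim X > 0")
  case True
  then obtain \<theta> where \<theta>: "principal_angle X Y \<theta>"
    "\<And>x. x \<in> X \<Longrightarrow> norm (x - orth_proj Y x) \<le> sin \<theta> * norm x"
    using ex_largest_principal_angle[OF X Y dim] by blast
  have "sin \<theta> \<le> \<theta>" using \<theta>(1) by (intro sin_x_le_x) (auto simp: principal_angle_def)
  also have "\<theta> \<le> subspace_angle X Y"
    unfolding subspace_angle_def using \<theta>(1)
    by (intro cSup_upper bdd_aboveI[of _ "pi / 2"]) (auto simp: principal_angle_def)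
  finally show ?thesis using \<theta>(2)[OF x] by (meson mult_right_mono norm_ge_zero order_trans)
next
  case False
  then have "X \<subseteq> {0}" by simp
  then have "x = 0" using x by blast
  moreover have "orth_proj Y 0 = 0" using Y by (intro orth_proj_unique) (auto simp: vec.subspace_0)
  ultimately show ?thesis by simp
qed

lemma subspace_angle_nonneg:
  fixes X Y :: "(complex ^ 'n) set"
  assumes X: "vec.subspace X" and Y: "vec.subspace Y" and dim: "vec.dim X = vec.dim Y"
    and pos: "vec.dim X > 0"
  shows "0 \<le> subspace_angle X Y"
proof -
  obtain \<theta> where \<theta>: "principal_angle X Y \<theta>"
    using ex_largest_principal_angle[OF X Y dim pos] by blast
  then have "\<theta> \<le> subspace_angle X Y"
    unfolding subspace_angle_def
    by (intro cSup_upper bdd_aboveI[of _ "pi / 2"]) (auto simp: principal_angle_def)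
  then show ?thesis using \<theta> by (auto simp: principal_angle_def)
qed

text \<open>The factor 2 is not optimal (\<open>pi / 2\<close> is).  Up to \<open>pi / 3\<close> the difference of the two sides is monotone,
  and beyond it \<open>2 * sin t\<close> is at least \<open>sqrt 3 > pi / 2\<close>.\<close>
lemma le_two_sin:
  fixes t :: real
  assumes "0 \<le> t" "t \<le> pi / 2"
  shows "t \<le> 2 * sin t"
proof (cases "t \<le> pi / 3")
  case True
  have "0 - 2 * sin 0 \<ge> t - 2 * sin t"
  proof (rule DERIV_nonpos_imp_nonincreasing[OF assms(1), where f = "\<lambda>t. t - 2 * sin t"])
    fix x assume x: "0 \<le> x" "x \<le> t"
    have "cos (pi / 3) \<le> cos x" using x True by (intro cos_monotone_0_pi_le) auto
    then have "1 - 2 * cos x \<le> 0" by (simp add: cos_60)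
    then show "\<exists>y. ((\<lambda>t. t - 2 * sin t) has_real_derivative y) (at x) \<and> y \<le> 0"
      by (intro exI[of _ "1 - 2 * cos x"]) (auto intro!: derivative_eq_intros)
  qed
  then show ?thesis by simp
next
  case False
  then have "sin (pi / 3) \<le> sin t" using assms by (intro sin_monotone_2pi_le) auto
  then have "sqrt 3 \<le> 2 * sin t" by (simp add: sin_60)
  moreover have "1.7 \<le> sqrt (3::real)" by (rule real_le_rsqrt) (simp add: power2_eq_square)
  moreover have "pi < 3.4" using pi_approx by simp
  ultimately show ?thesis using assms by simp
qed

text \<open>Each principal angle has a unit vector of \<open>X\<close> whose residual is exactly the sine of that angle.\<close>
lemma subspace_angle_le:
  fixes X Y :: "(complex ^ 'n) set"
  assumes X: "vec.subspace X" and Y: "vec.subspace Y" and dim: "vec.dim X = vec.dim Y"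
    and pos: "vec.dim X > 0"
    and s: "\<And>x. x \<in> X \<Longrightarrow> norm (x - orth_proj Y x) \<le> s * norm x"
  shows "subspace_angle X Y \<le> 2 * s"
  unfolding subspace_angle_def
proof (rule cSup_least)
  show "{\<theta>. principal_angle X Y \<theta>} \<noteq> {}" using ex_largest_principal_angle[OF X Y dim pos] by blast
  fix \<theta> assume "\<theta> \<in> {\<theta>. principal_angle X Y \<theta>}"
  then obtain x y where \<theta>: "0 \<le> \<theta>" "\<theta> \<le> pi / 2" and xy: "x \<in> X" "y \<in> Y" "norm x = 1" "norm y = 1"
    and o: "\<And>z. z \<in> Y \<Longrightarrow> inner (x - cos \<theta> *\<^sub>R y) z = 0"
    unfolding principal_angle_iff_inner[OF X Y] mem_Collect_eq by blast
  have "cos \<theta> *\<^sub>R y \<in> Y" using subspace_scale[OF subspace_if_vec_subspace[OF Y] xy(2)] .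
  then have P: "orth_proj Y x = cos \<theta> *\<^sub>R y" using o by (intro orth_proj_unique[OF Y]) auto
  have "(norm (x - cos \<theta> *\<^sub>R y))\<^sup>2 = (sin \<theta>)\<^sup>2"
    using norm_orth_proj_pythagoras[OF Y, of x] xy by (simp add: P sin_squared_eq)
  moreover have "0 \<le> sin \<theta>" using \<theta> by (intro sin_ge_zero) auto
  ultimately have "sin \<theta> = norm (x - orth_proj Y x)" by (simp add: P power2_eq_iff_nonneg)
  also have "\<dots> \<le> s" using s[OF xy(1)] xy(3) by simp
  finally show "\<theta> \<le> 2 * s" using le_two_sin[OF \<theta>] by simp
qed


section \<open>Entries and inverses of holomorphic matrix functions\<close>

lemma norm_matrix_vector_le_sum:
  fixes A :: "complex ^ 'm ^ 'n"
  shows "norm (A *v x) \<le> (\<Sum>i\<in>UNIV. \<Sum>j\<in>UNIV. cmod (A $ i $ j)) * norm x"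
proof -
  have "norm (A *v x) \<le> (\<Sum>i\<in>UNIV. norm ((A *v x) $ i))" 
    unfolding norm_vec_def by (rule L2_set_le_sum) simp
  also have "\<dots> \<le> (\<Sum>i\<in>UNIV. \<Sum>j\<in>UNIV. cmod (A $ i $ j) * norm x)"
  proof (rule sum_mono)
    fix i
    have "norm ((A *v x) $ i) \<le> (\<Sum>j\<in>UNIV. norm (A $ i $ j * x $ j))"
      by (simp add: matrix_vector_mult_def norm_sum)
    also have "\<dots> \<le> (\<Sum>j\<in>UNIV. cmod (A $ i $ j) * norm x)"
      by (intro sum_mono) (simp add: norm_mult mult_left_mono Finite_Cartesian_Product.norm_nth_le)
    finally show "norm ((A *v x) $ i) \<le> (\<Sum>j\<in>UNIV. cmod (A $ i $ j) * norm x)" .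
  qed
  finally show ?thesis by (simp add: sum_distrib_right)
qed

lemma matrix_vector_mult_scaleR_right:
  "A *v (r *\<^sub>R x) = r *\<^sub>R (A *v (x :: complex ^ 'm))"
  by (simp add: scaleR_eq_vec_scale vec.scale)

lemma linear_matrix_vector: "linear ((*v) (A :: complex ^ 'm ^ 'n))"
  by (rule linearI) (simp_all add: matrix_vector_right_distrib matrix_vector_mult_scaleR_right)

lemma bounded_linear_matrix_vector: "bounded_linear ((*v) (A :: complex ^ 'm ^ 'n))"
  using linear_matrix_vector linear_conv_bounded_linear by blast

lemma norm_matrix_vector_le_spectral_norm: "norm (A *v x) \<le> spectral_norm A * norm x"
  unfolding spectral_norm_def by (rule onorm[OF bounded_linear_matrix_vector])

lemma matrix_vector_mult_axis: "A *v axis j 1 = column j (A :: complex ^ 'm ^ 'n)"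
  by (simp add: vec_eq_iff matrix_vector_mult_def column_def axis_def if_distrib cong: if_cong)

lemma matrix_inv_inverse:
  assumes "invertible A"
  shows "A ** matrix_inv A = mat 1" "matrix_inv A ** A = mat 1"
  using someI_ex[OF assms[unfolded invertible_def]] unfolding matrix_inv_def by auto

lemma matrix_inv_unique:
  assumes "A ** B = mat 1" "B ** A = mat 1"
  shows "matrix_inv A = B"
proof -
  have "invertible A" using assms unfolding invertible_def by blast
  then have "matrix_inv A = B ** A ** matrix_inv A" by (simp add: assms)
  also have "\<dots> = B" using \<open>invertible A\<close> by (simp add: matrix_mul_assoc[symmetric] matrix_inv_inverse)
  finally show ?thesis .
qed

text \<open>Cramer's rule, which makes holomorphy of the inverse visible.\<close>
lemma matrix_inv_entry:
  fixes A :: "complex ^ 'n ^ 'n"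
  assumes "invertible A"
  shows "matrix_inv A $ k $ j
    = det (\<chi> i l. if l = k then axis j 1 $ i else A $ i $ l) / det A"
proof -
  have nz: "det A \<noteq> 0" using assms by (simp add: invertible_det_nz)
  have inv: "A ** matrix_inv A = mat 1"
    using assms by (rule matrix_inv_inverse)
  have "A *v (matrix_inv A *v axis j 1) = axis j 1"
    by (simp add: matrix_vector_mul_assoc inv)
  then have "matrix_inv A *v axis j 1
      = (\<chi> k. det (\<chi> i l. if l = k then axis j 1 $ i else A $ i $ l) / det A)"
    using cramer[OF nz] by blast
  moreover have "(matrix_inv A *v axis j 1) $ k = matrix_inv A $ k $ j"
    by (simp add: matrix_vector_mult_axis column_def)
  ultimately show ?thesis by simp
qed

lemma holomorphic_det:
  fixes T :: "complex \<Rightarrow> complex ^ 'n ^ 'n"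
  assumes "matrix_holomorphic_on T S"
  shows "(\<lambda>z. det (T z)) holomorphic_on S"
  using assms unfolding det_def matrix_holomorphic_on_def
  by (intro holomorphic_intros) auto

lemma holomorphic_matrix_inv:
  fixes T :: "complex \<Rightarrow> complex ^ 'n ^ 'n"
  assumes T: "matrix_holomorphic_on T S" and inv: "\<And>z. z \<in> S \<Longrightarrow> invertible (T z)"
  shows "matrix_holomorphic_on (\<lambda>z. matrix_inv (T z)) S"
  unfolding matrix_holomorphic_on_def
proof (intro allI)
  fix k j
  have "matrix_holomorphic_on (\<lambda>z. \<chi> i l. if l = k then axis j 1 $ i else T z $ i $ l) S"
    unfolding matrix_holomorphic_on_def
  proof (intro allI)
    fix a b show "(\<lambda>z. (\<chi> i l. if l = k then axis j 1 $ i else T z $ i $ l) $ a $ b) holomorphic_on S"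
      using T by (cases "b = k") (auto simp: matrix_holomorphic_on_def)
  qed
  then have "(\<lambda>z. det (\<chi> i l. if l = k then axis j 1 $ i else T z $ i $ l) / det (T z)) holomorphic_on S"
    using T inv by (intro holomorphic_on_divide holomorphic_det) (auto simp: invertible_det_nz)
  then show "(\<lambda>z. matrix_inv (T z) $ k $ j) holomorphic_on S"
    by (rule holomorphic_transform) (simp add: matrix_inv_entry inv)
qed

lemma open_invertible_points:
  fixes T :: "complex \<Rightarrow> complex ^ 'n ^ 'n"
  assumes "open \<Omega>" "matrix_holomorphic_on T \<Omega>"
  shows "open {z \<in> \<Omega>. invertible (T z)}"
proof -
  have "continuous_on \<Omega> (\<lambda>z. det (T z))"
    using holomorphic_det[OF assms(2)] holomorphic_on_imp_continuous_on by blast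
  then have "open (\<Omega> \<inter> (\<lambda>z. det (T z)) -` (- {0}))"
    by (rule continuous_open_preimage[OF _ assms(1)]) auto
  moreover have "\<Omega> \<inter> (\<lambda>z. det (T z)) -` (- {0}) = {z \<in> \<Omega>. invertible (T z)}"
    by (auto simp: invertible_det_nz)
  ultimately show ?thesis by simp
qed

lemma invertible_iff_no_eigenvector:
  fixes T :: "complex \<Rightarrow> complex ^ 'n ^ 'n"
  shows "invertible (T z) \<longleftrightarrow> \<not> (\<exists>v. eigenpair T z v)"
  unfolding invertible_left_inverse matrix_left_invertible_ker eigenpair_def by blast

lemma matrix_inv_diag:
  fixes \<mu> :: "'m::finite \<Rightarrow> complex"
  assumes "z \<notin> range \<mu>"
  shows "matrix_inv (mat z - diag \<mu>) = diag (\<lambda>i. 1 / (z - \<mu> i))"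
proof -
  have eq: "mat z - diag \<mu> = diag (\<lambda>i. z - \<mu> i)"
    by (simp add: mat_def diag_def vec_eq_iff)
  have d: "diag a ** diag b = diag (\<lambda>i. a i * b i)" for a b :: "'m \<Rightarrow> complex"
    by (simp add: diag_def matrix_matrix_mult_def vec_eq_iff if_distrib[of "\<lambda>x. x * _"] cong: if_cong)
  have nz: "z \<noteq> \<mu> i" for i using assms by auto
  have one: "diag (\<lambda>i. 1) = mat 1" by (simp add: diag_def mat_def)
  show ?thesis unfolding eq
    by (rule matrix_inv_unique) (simp_all add: d nz one)
qed

lemma matrix_mult_entry: "(A ** B) $ i $ j = (\<Sum>k\<in>UNIV. A $ i $ k * B $ k $ j)"
  by (simp add: matrix_matrix_mult_def)

lemma matrix_add_mult: "(A + B) ** C = A ** C + B ** (C :: complex ^ 'k ^ 'm)"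
  by (simp add: vec_eq_iff matrix_mult_entry distrib_right sum.distrib)

text \<open>With the resolvent of \<open>diag \<mu>\<close> in the middle, the dependence on the spectral parameter sits in the
  scalars \<open>d i\<close> alone.\<close>
lemma keldysh_entry:
  fixes U :: "complex ^ 'm ^ 'n" and W :: "complex ^ 'n ^ 'm" and B :: "complex ^ 'n ^ 'n"
  shows "(U ** diag d ** W ** B) $ a $ b = (\<Sum>i\<in>UNIV. d i * (U $ a $ i * (W ** B) $ i $ b))"
proof -
  have "(U ** diag d) $ a $ i = d i * U $ a $ i" for i
    by (simp add: matrix_mult_entry diag_def if_distrib[of "\<lambda>x. _ * x"] mult.commute cong: if_cong)
  then show ?thesis
    unfolding matrix_mul_assoc[of "U ** diag d" W B, symmetric] matrix_mult_entry[of "U ** diag d" "W ** B"]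
    by (simp add: mult.assoc)
qed


section \<open>The contour filter\<close>

lemma keldysh_at_invertible:
  assumes "keldysh_decomposition \<Omega> D T \<mu> u w H" "z \<in> \<Omega>" "invertible (T z)" "z \<notin> range \<mu>"
  shows "matrix_inv (T z) = of_columns u ** diag (\<lambda>i. 1 / (z - \<mu> i)) ** ctranspose (of_columns w) + H z"
  using assms by (simp add: keldysh_decomposition_def matrix_inv_diag)

lemma holomorphic_matrix_mult_entry:
  assumes "matrix_holomorphic_on A S"
  shows "(\<lambda>z. (A z ** B) $ i $ j) holomorphic_on S"
  using assms unfolding matrix_mult_entry matrix_holomorphic_on_def
  by (intro holomorphic_intros) auto

text \<open>Cauchy's formula needs \<open>H\<close> holomorphic across the boundary curve.  There \<open>T\<close> is invertible, and the
  defining identity of \<open>H\<close> supplies the continuation.\<close>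
lemma keldysh_holomorphic_extension:
  fixes T :: "complex \<Rightarrow> complex ^ 'n ^ 'n" and \<mu> :: "'m::finite \<Rightarrow> complex"
  assumes K: "keldysh_decomposition \<Omega> D T \<mu> u w H"
    and \<Omega>: "open \<Omega>" "matrix_holomorphic_on T \<Omega>" and D: "open D"
    and \<mu>: "\<And>i. \<not> invertible (T (\<mu> i))"
  shows "matrix_holomorphic_on H (D \<union> {z \<in> \<Omega>. invertible (T z)})"
  unfolding matrix_holomorphic_on_def
proof (intro allI)
  fix a b
  let ?V = "{z \<in> \<Omega>. invertible (T z)}"
  have "(\<lambda>z. matrix_inv (T z) $ a $ b
      - (\<Sum>i\<in>UNIV. 1 / (z - \<mu> i) * (of_columns u $ a $ i * (ctranspose (of_columns w) ** mat 1) $ i $ b)))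
      holomorphic_on ?V"
  proof (intro holomorphic_intros)
    have "matrix_holomorphic_on T ?V"
      using \<Omega>(2) by (auto simp: matrix_holomorphic_on_def intro: holomorphic_on_subset)
    then have "matrix_holomorphic_on (\<lambda>z. matrix_inv (T z)) ?V"
      by (rule holomorphic_matrix_inv) simp
    then show "(\<lambda>z. matrix_inv (T z) $ a $ b) holomorphic_on ?V"
      by (simp add: matrix_holomorphic_on_def)
  qed (use \<mu> in auto)
  then have "(\<lambda>z. H z $ a $ b) holomorphic_on ?V"
  proof (rule holomorphic_transform)
    fix z assume z: "z \<in> ?V"
    then have "z \<notin> range \<mu>" using \<mu> by auto
    then have "matrix_inv (T z) $ a $ b
      = (of_columns u ** diag (\<lambda>i. 1 / (z - \<mu> i)) ** ctranspose (of_columns w) ** mat 1) $ a $ b + H z $ a $ b"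
      using keldysh_at_invertible[OF K] z by simp
    then show "matrix_inv (T z) $ a $ b
      - (\<Sum>i\<in>UNIV. 1 / (z - \<mu> i) * (of_columns u $ a $ i * (ctranspose (of_columns w) ** mat 1) $ i $ b))
      = H z $ a $ b"
      by (simp only: keldysh_entry) simp
  qed
  moreover have "(\<lambda>z. H z $ a $ b) holomorphic_on D"
    using K by (simp add: keldysh_decomposition_def matrix_holomorphic_on_def)
  ultimately show "(\<lambda>z. H z $ a $ b) holomorphic_on D \<union> ?V"
    using open_invertible_points[OF \<Omega>] D by (intro holomorphic_on_Un)
qed

text \<open>By partial fractions the integrand is a combination of simple poles at \<open>\<rho>\<close> and at the eigenvalues, plus
  a Cauchy kernel for \<open>H\<close>.  The singular part contributes differences of two residues that both equal
  one, so it drops out and only the value of \<open>H\<close> at \<open>\<rho>\<close> survives.\<close>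
lemma filter_ci_eq:
  fixes T :: "complex \<Rightarrow> complex ^ 'n ^ 'n" and \<mu> :: "'m::finite \<Rightarrow> complex"
    and g :: "real \<Rightarrow> complex"
  assumes g: "rectifiable_path g" "pathfinish g = pathstart g"
    and D: "D = inside (path_image g)" "\<And>z. z \<in> D \<Longrightarrow> winding_number g z = 1"
    and \<Omega>: "open \<Omega>" "matrix_holomorphic_on T \<Omega>" "D \<subseteq> \<Omega>" "path_image g \<subseteq> \<Omega>"
    and boundary: "\<And>z. z \<in> path_image g \<Longrightarrow> invertible (T z)"
    and \<mu>: "range \<mu> = eigenvalues_in D T"
    and K: "keldysh_decomposition \<Omega> D T \<mu> u w H"
    and \<rho>: "\<rho> \<in> D" "invertible (T \<rho>)"
  shows "filter_ci g T \<rho> = mat 1 - H \<rho> ** T \<rho>"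
proof -
  have pg: "path g" using g by (simp add: rectifiable_path_def)
  have openD: "open D" unfolding D(1)
    by (simp add: open_inside compact_imp_closed compact_path_image pg)
  have \<mu>D: "\<mu> i \<in> D" and \<mu>sing: "\<not> invertible (T (\<mu> i))" for i
    using \<mu> invertible_iff_no_eigenvector[of T] unfolding eigenvalues_in_def by auto
  have invD: "invertible (T z)" if "z \<in> D" "z \<notin> range \<mu>" for z
    using that \<mu> invertible_iff_no_eigenvector[of T] unfolding eigenvalues_in_def by blast
  have \<rho>\<mu>: "\<rho> \<noteq> \<mu> i" for i using \<rho> \<mu>sing by metis
  define S where "S = D \<union> {z \<in> \<Omega>. invertible (T z)}"
  define S0 where "S0 = S - insert \<rho> (range \<mu>)"
  have S: "open S" using openD open_invertible_points[OF \<Omega>(1,2)] by (simp add: S_def open_Un)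
  have S0: "open S0" unfolding S0_def by (intro open_Diff S finite_imp_closed) simp
  have inv0: "invertible (T z)" "z \<in> \<Omega>" "z \<noteq> \<rho>" "z \<notin> range \<mu>" if "z \<in> S0" for z
    using that invD \<Omega>(3) by (auto simp: S0_def S_def)
  have disj: "path_image g \<inter> D = {}" unfolding D(1) using inside_no_overlap by blast
  have gS0: "path_image g \<subseteq> S0"
    using disj \<rho>(1) \<mu>D boundary \<Omega>(4) by (auto simp: S0_def S_def)
  obtain p where p: "valid_path p" "pathfinish p = pathstart p" "path_image p \<subseteq> S0"
    and wind: "\<And>z. z \<notin> S0 \<Longrightarrow> winding_number p z = winding_number g z"
    and int: "\<And>f. f holomorphic_on S0 \<Longrightarrow> has_curve_integral f (contour_integral p f) g"
    using curve_integral_homologous_path[OF g S0 gS0] by metis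
  have wind_D: "winding_number p z = 1" "z \<notin> path_image p" if "z \<in> D" "z \<notin> S0" for z
    using that wind D(2) p(3) by auto
  have wind_out: "winding_number p z = 0" if "z \<notin> S" for z
  proof -
    have "z \<notin> D" "z \<notin> path_image g" using that gS0 by (auto simp: S_def S0_def)
    then have "z \<in> outside (path_image g)" unfolding D(1) using inside_Un_outside by blast
    then have "winding_number g z = 0" using winding_number_zero_in_outside[OF pg g(2)] by blast
    then show ?thesis using wind[of z] that by (simp add: S0_def)
  qed
  have holH: "matrix_holomorphic_on H S"
    unfolding S_def by (rule keldysh_holomorphic_extension[OF K \<Omega>(1,2) openD \<mu>sing])
  have residue: "((\<lambda>z. 1 / (z - \<zeta>)) has_contour_integral 2 * pi * \<i>) p" if "\<zeta> \<in> D" "\<zeta> \<notin> S0" for \<zeta>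
    using has_contour_integral_winding_number[OF p(1) wind_D(2)[OF that]] wind_D(1)[OF that] by simp
  have res\<rho>: "((\<lambda>z. 1 / (z - \<rho>)) has_contour_integral 2 * pi * \<i>) p"
    using residue \<rho>(1) by (simp add: S0_def)
  have res\<mu>: "((\<lambda>z. 1 / (z - \<mu> i)) has_contour_integral 2 * pi * \<i>) p" for i
    using residue[OF \<mu>D] by (simp add: S0_def)
  show ?thesis
    unfolding vec_eq_iff
  proof (intro allI)
    fix a b
    define f where "f z = mscale (1 / (z - \<rho>)) (mat 1 - matrix_inv (T z) ** T \<rho>) $ a $ b" for z
    define \<delta> where "\<delta> = (mat 1 :: complex ^ 'n ^ 'n) $ a $ b"
    define h where "h z = (H z ** T \<rho>) $ a $ b" for z
    define c where "c i = of_columns u $ a $ i * (ctranspose (of_columns w) ** T \<rho>) $ i $ b" for i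
    have holh: "h holomorphic_on S" unfolding h_def by (rule holomorphic_matrix_mult_entry[OF holH])
    have "S0 \<subseteq> S" by (auto simp: S0_def)
    then have hS0: "h holomorphic_on S0" by (rule holomorphic_on_subset[OF holh])
    have nz: "z \<noteq> \<rho>" "z \<noteq> \<mu> i" if "z \<in> S0" for z i using inv0(3,4)[OF that] by auto
    have split: "f z = \<delta> * (1 / (z - \<rho>))
        - (\<Sum>i\<in>UNIV. c i / (\<rho> - \<mu> i) * (1 / (z - \<rho>) - 1 / (z - \<mu> i))) - h z / (z - \<rho>)"
      if "z \<in> S0" for z
    proof -
      have "(matrix_inv (T z) ** T \<rho>) $ a $ b = (\<Sum>i\<in>UNIV. 1 / (z - \<mu> i) * c i) + h z"
        using keldysh_at_invertible[OF K inv0(2,1,4)[OF that]]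
        by (simp add: matrix_add_mult keldysh_entry c_def h_def)
      then have "f z = 1 / (z - \<rho>) * (\<delta> - (\<Sum>i\<in>UNIV. 1 / (z - \<mu> i) * c i) - h z)"
        by (simp add: f_def mscale_def \<delta>_def)
      also have "\<dots> = \<delta> * (1 / (z - \<rho>)) - (\<Sum>i\<in>UNIV. 1 / (z - \<rho>) * (1 / (z - \<mu> i) * c i)) - h z / (z - \<rho>)"
        by (simp add: right_diff_distrib sum_distrib_left)
      also have "(\<Sum>i\<in>UNIV. 1 / (z - \<rho>) * (1 / (z - \<mu> i) * c i))
          = (\<Sum>i\<in>UNIV. c i / (\<rho> - \<mu> i) * (1 / (z - \<rho>) - 1 / (z - \<mu> i)))"
      proof (rule sum.cong[OF refl])
        fix i
        have "z - \<rho> \<noteq> 0" "z - \<mu> i \<noteq> 0" "\<rho> - \<mu> i \<noteq> 0" using inv0(3,4)[OF that] \<rho>\<mu> by auto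
        then show "1 / (z - \<rho>) * (1 / (z - \<mu> i) * c i)
            = c i / (\<rho> - \<mu> i) * (1 / (z - \<rho>) - 1 / (z - \<mu> i))"
          by (simp add: divide_simps)
      qed
      finally show ?thesis .
    qed
    have "(\<lambda>z. \<delta> * (1 / (z - \<rho>))
        - (\<Sum>i\<in>UNIV. c i / (\<rho> - \<mu> i) * (1 / (z - \<rho>) - 1 / (z - \<mu> i))) - h z / (z - \<rho>)) holomorphic_on S0"
      by (intro holomorphic_intros hS0; simp add: nz)
    then have "f holomorphic_on S0"
      by (rule holomorphic_transform) (simp add: split)
    then have curve: "curve_integral g f = contour_integral p f"
      by (intro curve_integral_eqI int)
    have "((\<lambda>z. h z / (z - \<rho>)) has_contour_integral 2 * pi * \<i> * winding_number p \<rho> * h \<rho>) p"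
      using \<rho>(1) p wind_out by (intro Cauchy_integral_formula_global[OF S holh]) (auto simp: S_def S0_def)
    then have hint: "((\<lambda>z. h z / (z - \<rho>)) has_contour_integral 2 * pi * \<i> * h \<rho>) p"
      using wind_D(1)[of \<rho>] \<rho>(1) by (simp add: S0_def)
    have "((\<lambda>z. \<delta> * (1 / (z - \<rho>))
        - (\<Sum>i\<in>UNIV. c i / (\<rho> - \<mu> i) * (1 / (z - \<rho>) - 1 / (z - \<mu> i))) - h z / (z - \<rho>))
        has_contour_integral
        \<delta> * (2 * pi * \<i>) - (\<Sum>i\<in>UNIV. c i / (\<rho> - \<mu> i) * (2 * pi * \<i> - 2 * pi * \<i>)) - 2 * pi * \<i> * h \<rho>) p"
      by (intro has_contour_integral_diff has_contour_integral_lmul has_contour_integral_sum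
          res\<rho> res\<mu> hint) simp
    then have "(f has_contour_integral
        \<delta> * (2 * pi * \<i>) - (\<Sum>i\<in>UNIV. c i / (\<rho> - \<mu> i) * (2 * pi * \<i> - 2 * pi * \<i>)) - 2 * pi * \<i> * h \<rho>) p"
      by (rule has_contour_integral_eq) (use split p(3) in auto)
    then have "contour_integral p f = 2 * pi * \<i> * (\<delta> - h \<rho>)"
      by (simp add: contour_integral_unique algebra_simps)
    then have "1 / (2 * of_real pi * \<i>) * curve_integral g f = \<delta> - h \<rho>"
      by (simp add: curve)
    moreover have "f = (\<lambda>z. mscale (1 / (z - \<rho>)) (mat 1 - matrix_inv (T z) ** T \<rho>) $ a $ b)"
      by (simp add: fun_eq_iff f_def)
    ultimately show "filter_ci g T \<rho> $ a $ b = (mat 1 - H \<rho> ** T \<rho>) $ a $ b"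
      by (simp add: filter_ci_def \<delta>_def h_def)
  qed
qed


section \<open>The quadrature filter\<close>

text \<open>The complementary projection, used as a linear operator that annihilates \<open>Y\<close>.\<close>

definition orth_residual :: "(complex ^ 'n) set \<Rightarrow> complex ^ 'n \<Rightarrow> complex ^ 'n" where
  "orth_residual Y x = x - orth_proj Y x"

lemma linear_orth_residual:
  assumes "vec.subspace Y"
  shows "Vector_Spaces.linear (*s) (*s) (orth_residual Y)"
proof -
  interpret l: Vector_Spaces.linear "(*s)" "(*s)" "orth_proj Y" using linear_orth_proj[OF assms] .
  show ?thesis
    by unfold_locales (simp_all add: orth_residual_def l.add l.scale vec.scale_right_diff_distrib)
qed

lemma bounded_linear_orth_residual:
  assumes "vec.subspace Y"
  shows "bounded_linear (orth_residual Y)"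
  unfolding orth_residual_def[abs_def]
  by (intro bounded_linear_sub bounded_linear_ident bounded_linear_orth_proj assms)

lemma norm_orth_residual_le:
  assumes "vec.subspace Y"
  shows "norm (orth_residual Y x) \<le> norm x"
  using norm_residual_le[OF assms vec.subspace_0[OF assms], of x] by (simp add: orth_residual_def)

lemma norm_orth_residual_le_dist:
  assumes "vec.subspace Y" "y \<in> Y"
  shows "norm (orth_residual Y x) \<le> norm (x - y)"
  unfolding orth_residual_def by (rule norm_residual_le[OF assms])

lemma orth_residual_eq_0:
  assumes "vec.subspace Y" "y \<in> Y"
  shows "orth_residual Y y = 0"
  using norm_orth_residual_le_dist[OF assms, of y] by simp

lemma of_columns_mult: "of_columns z *v c = (\<Sum>i\<in>UNIV. c $ i *s z i)"
  by (simp add: vec_eq_iff of_columns_def matrix_vector_mult_def sum_component mult.commute)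

lemma of_columns_mult_in_span: "of_columns z *v c \<in> vec.span (range z)"
  unfolding of_columns_mult by (intro vec.span_sum vec.span_scale vec.span_base) simp

text \<open>At a node the numerator vanishes and the term is a difference quotient, so the singularity is
  removable.\<close>
lemma tendsto_filter_term:
  fixes T :: "complex \<Rightarrow> complex ^ 'n ^ 'n"
  assumes \<Omega>: "open \<Omega>" "matrix_holomorphic_on T \<Omega>" "\<rho>\<^sub>0 \<in> \<Omega>" and inv: "invertible (T \<zeta>)"
  shows "\<exists>L. ((\<lambda>\<rho>. mscale (c / (\<zeta> - \<rho>)) (mat 1 - matrix_inv (T \<zeta>) ** T \<rho>)) \<longlongrightarrow> L) (at \<rho>\<^sub>0)
     \<and> (\<zeta> \<noteq> \<rho>\<^sub>0 \<longrightarrow> L = mscale (c / (\<zeta> - \<rho>\<^sub>0)) (mat 1 - matrix_inv (T \<zeta>) ** T \<rho>\<^sub>0))"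
proof -
  define h where "h a b \<rho> = (mat 1 - matrix_inv (T \<zeta>) ** T \<rho>) $ a $ b" for a b \<rho>
  have hol: "h a b holomorphic_on \<Omega>" for a b
    using \<Omega>(2) unfolding h_def[abs_def] vector_minus_component matrix_mult_entry matrix_holomorphic_on_def
    by (intro holomorphic_intros) auto
  have "\<exists>l. ((\<lambda>\<rho>. c / (\<zeta> - \<rho>) * h a b \<rho>) \<longlongrightarrow> l) (at \<rho>\<^sub>0)
     \<and> (\<zeta> \<noteq> \<rho>\<^sub>0 \<longrightarrow> l = c / (\<zeta> - \<rho>\<^sub>0) * h a b \<rho>\<^sub>0)" for a b
  proof (cases "\<zeta> = \<rho>\<^sub>0")
    case False
    have "isCont (h a b) \<rho>\<^sub>0"
      using hol \<Omega> holomorphic_on_imp_continuous_on continuous_on_eq_continuous_at by blast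
    then have "((\<lambda>\<rho>. c / (\<zeta> - \<rho>) * h a b \<rho>) \<longlongrightarrow> c / (\<zeta> - \<rho>\<^sub>0) * h a b \<rho>\<^sub>0) (at \<rho>\<^sub>0)"
      using False by (intro tendsto_intros isContD) auto
    then show ?thesis by blast
  next
    case True
    obtain d where "(h a b has_field_derivative d) (at \<rho>\<^sub>0)"
      using hol[of a b] \<Omega> by (metis field_differentiable_def holomorphic_on_imp_differentiable_at)
    then have "((\<lambda>\<rho>. (h a b \<rho> - h a b \<rho>\<^sub>0) / (\<rho> - \<rho>\<^sub>0)) \<longlongrightarrow> d) (at \<rho>\<^sub>0)"
      by (simp add: has_field_derivative_iff)
    then have "((\<lambda>\<rho>. - c * ((h a b \<rho> - h a b \<rho>\<^sub>0) / (\<rho> - \<rho>\<^sub>0))) \<longlongrightarrow> - c * d) (at \<rho>\<^sub>0)"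
      by (intro tendsto_intros)
    moreover have "h a b \<rho>\<^sub>0 = 0"
      using True inv by (simp add: h_def matrix_inv_inverse)
    moreover have "c / (\<zeta> - \<rho>) = - (c / (\<rho> - \<rho>\<^sub>0))" for \<rho>
      using True by (metis minus_diff_eq minus_divide_right)
    ultimately have "((\<lambda>\<rho>. c / (\<zeta> - \<rho>) * h a b \<rho>) \<longlongrightarrow> - c * d) (at \<rho>\<^sub>0)"
      by simp
    then show ?thesis using True by blast
  qed
  then obtain l where l: "\<And>a b. ((\<lambda>\<rho>. c / (\<zeta> - \<rho>) * h a b \<rho>) \<longlongrightarrow> l a b) (at \<rho>\<^sub>0)"
     "\<And>a b. \<zeta> \<noteq> \<rho>\<^sub>0 \<Longrightarrow> l a b = c / (\<zeta> - \<rho>\<^sub>0) * h a b \<rho>\<^sub>0" by metis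
  show ?thesis
  proof (intro exI conjI impI)
    show "((\<lambda>\<rho>. mscale (c / (\<zeta> - \<rho>)) (mat 1 - matrix_inv (T \<zeta>) ** T \<rho>)) \<longlongrightarrow> (\<chi> a b. l a b)) (at \<rho>\<^sub>0)"
      using l(1) by (intro vec_tendstoI) (simp add: mscale_def h_def)
    show "(\<chi> a b. l a b) = mscale (c / (\<zeta> - \<rho>\<^sub>0)) (mat 1 - matrix_inv (T \<zeta>) ** T \<rho>\<^sub>0)" if "\<zeta> \<noteq> \<rho>\<^sub>0"
      using l(2)[OF that] by (simp add: vec_eq_iff mscale_def h_def)
  qed
qed

text \<open>The filter at a node is the limit of the sum there.  Estimates proved off the nodes therefore
  extend to all points.\<close>
lemma tendsto_filter_nl:
  fixes T :: "complex \<Rightarrow> complex ^ 'n ^ 'n"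
  assumes \<Omega>: "open \<Omega>" "matrix_holomorphic_on T \<Omega>" "\<rho>\<^sub>0 \<in> \<Omega>"
    and inv: "\<And>j. j \<in> {1..N} \<Longrightarrow> invertible (T (\<xi> j))"
  shows "(filter_nl_sum N \<xi> \<omega> T \<longlongrightarrow> filter_nl N \<xi> \<omega> T \<rho>\<^sub>0) (at \<rho>\<^sub>0)"
proof -
  have "\<exists>L. \<forall>j\<in>{1..N}. ((\<lambda>\<rho>. mscale (\<omega> j / (\<xi> j - \<rho>)) (mat 1 - matrix_inv (T (\<xi> j)) ** T \<rho>)) \<longlongrightarrow> L j) (at \<rho>\<^sub>0)
     \<and> (\<xi> j \<noteq> \<rho>\<^sub>0 \<longrightarrow> L j = mscale (\<omega> j / (\<xi> j - \<rho>\<^sub>0)) (mat 1 - matrix_inv (T (\<xi> j)) ** T \<rho>\<^sub>0))"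
    by (intro bchoice ballI tendsto_filter_term[OF \<Omega>] inv)
  then obtain L where L: "\<And>j. j \<in> {1..N} \<Longrightarrow>
      ((\<lambda>\<rho>. mscale (\<omega> j / (\<xi> j - \<rho>)) (mat 1 - matrix_inv (T (\<xi> j)) ** T \<rho>)) \<longlongrightarrow> L j) (at \<rho>\<^sub>0)"
     "\<And>j. j \<in> {1..N} \<Longrightarrow> \<xi> j \<noteq> \<rho>\<^sub>0 \<Longrightarrow>
       L j = mscale (\<omega> j / (\<xi> j - \<rho>\<^sub>0)) (mat 1 - matrix_inv (T (\<xi> j)) ** T \<rho>\<^sub>0)"
    by blast
  have lim: "(filter_nl_sum N \<xi> \<omega> T \<longlongrightarrow> (\<Sum>j=1..N. L j)) (at \<rho>\<^sub>0)"
    unfolding filter_nl_sum_def[abs_def] by (intro tendsto_sum L(1))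
  have "filter_nl N \<xi> \<omega> T \<rho>\<^sub>0 = (\<Sum>j=1..N. L j)"
  proof (cases "\<rho>\<^sub>0 \<in> \<xi> ` {1..N}")
    case True
    then show ?thesis using tendsto_Lim[OF _ lim] by (simp add: filter_nl_def)
  next
    case False
    then have "\<xi> j \<noteq> \<rho>\<^sub>0" if "j \<in> {1..N}" for j using that by blast
    then show ?thesis using False L(2) by (simp add: filter_nl_def filter_nl_sum_def)
  qed
  then show ?thesis using lim by simp
qed

lemma tendsto_matrix_vector:
  fixes A :: "'a \<Rightarrow> complex ^ 'm ^ 'n"
  assumes "(A \<longlongrightarrow> L) F"
  shows "((\<lambda>t. A t *v x) \<longlongrightarrow> L *v x) F"
  unfolding matrix_vector_mult_def
  by (intro vec_tendstoI) (auto intro!: tendsto_intros tendsto_vec_nth assms)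

lemma isCont_matrix_vector:
  assumes "matrix_holomorphic_on A S" "open S" "z \<in> S"
  shows "((\<lambda>z. A z *v x) \<longlongrightarrow> A z *v x) (at z)"
proof (rule tendsto_matrix_vector)
  have "isCont (\<lambda>z. A z $ i $ j) z" for i j
    using assms holomorphic_on_imp_continuous_on continuous_on_eq_continuous_at
    unfolding matrix_holomorphic_on_def by blast
  then show "(A \<longlongrightarrow> A z) (at z)" by (intro vec_tendstoI) (auto dest: isContD)
qed

text \<open>The singular part of the inverse maps into the span of the eigenvectors.\<close>
lemma keldysh_residual:
  assumes "keldysh_decomposition \<Omega> D T \<mu> u w H" "z \<in> \<Omega>" "invertible (T z)"
  shows "orth_residual (vec.span (range u)) (matrix_inv (T z) *v y)
    = orth_residual (vec.span (range u)) (H z *v y)"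
proof -
  let ?U = "vec.span (range u)"
  interpret R: Vector_Spaces.linear "(*s)" "(*s)" "orth_residual ?U"
    by (rule linear_orth_residual) simp
  have "matrix_inv (T z) = of_columns u ** (matrix_inv (mat z - diag \<mu>) ** ctranspose (of_columns w)) + H z"
    using assms by (simp add: keldysh_decomposition_def matrix_mul_assoc)
  then have "matrix_inv (T z) *v y
      = of_columns u *v ((matrix_inv (mat z - diag \<mu>) ** ctranspose (of_columns w)) *v y) + H z *v y"
    by (simp only: matrix_vector_mult_add_rdistrib matrix_vector_mul_assoc)
  then show ?thesis
    by (simp only: R.add orth_residual_eq_0[OF vec.subspace_span of_columns_mult_in_span] add_0_left)
qed

lemma mscale_mult_vector: "mscale c A *v x = c *s (A *v x)"
  by (simp add: vec_eq_iff mscale_def matrix_vector_mult_def sum_distrib_left mult.assoc)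

lemma sum_matrix_vector: "(\<Sum>j\<in>I. A j) *v x = (\<Sum>j\<in>I. A j *v (x :: complex ^ 'm))"
  by (induction I rule: infinite_finite_induct) (simp_all add: matrix_vector_mult_add_rdistrib)

lemma residual_filter_sum:
  fixes T :: "complex \<Rightarrow> complex ^ 'n ^ 'n" and u :: "'m::finite \<Rightarrow> complex ^ 'n"
  assumes K: "keldysh_decomposition \<Omega> D T \<mu> u w H"
    and nodes: "\<And>j. j \<in> {1..N} \<Longrightarrow> \<xi> j \<in> \<Omega> \<and> invertible (T (\<xi> j))"
  defines "R \<equiv> orth_residual (vec.span (range u))"
  shows "R (filter_nl_sum N \<xi> \<omega> T \<rho> *v v) = (\<Sum>j=1..N. \<omega> j / (\<xi> j - \<rho>)) *s R v
     - R ((\<Sum>j=1..N. mscale (\<omega> j / (\<xi> j - \<rho>)) (H (\<xi> j))) *v (T \<rho> *v v))"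
proof -
  interpret R: Vector_Spaces.linear "(*s)" "(*s)" R
    unfolding R_def by (rule linear_orth_residual) simp
  have "R (filter_nl_sum N \<xi> \<omega> T \<rho> *v v)
     = (\<Sum>j=1..N. (\<omega> j / (\<xi> j - \<rho>)) *s (R v - R (matrix_inv (T (\<xi> j)) *v (T \<rho> *v v))))"
    by (simp add: filter_nl_sum_def sum_matrix_vector mscale_mult_vector R.sum R.scale R.diff
        matrix_vector_mult_diff_rdistrib matrix_vector_mul_assoc)
  also have "\<dots> = (\<Sum>j=1..N. (\<omega> j / (\<xi> j - \<rho>)) *s (R v - R (H (\<xi> j) *v (T \<rho> *v v))))"
    using keldysh_residual[OF K] nodes unfolding R_def by (intro sum.cong) auto
  also have "\<dots> = (\<Sum>j=1..N. \<omega> j / (\<xi> j - \<rho>)) *s R v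
     - R ((\<Sum>j=1..N. mscale (\<omega> j / (\<xi> j - \<rho>)) (H (\<xi> j))) *v (T \<rho> *v v))"
    by (simp add: vec.scale_right_diff_distrib sum_subtractf vec.scale_sum_left
        sum_matrix_vector mscale_mult_vector R.sum R.scale)
  finally show ?thesis .
qed

text \<open>The first estimate compares with the contour filter.  For the second, let \<open>r\<close> be the sum of the
  scalar weights and \<open>E\<close> the quadrature error for \<open>H\<close>; then
  \<open>R (F v) = (r - 1) R v - R (E (T \<rho> v))\<close>.  No hypothesis bounds \<open>r - 1\<close>, but applying the identity to
  \<open>R v\<close> in place of \<open>v\<close> and subtracting the contour filter, whose values have no residual, bounds
  exactly the term \<open>(r - 1) R v\<close> that is needed, also when the eigenvectors span the whole space.\<close>
lemma filter_sum_estimates: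
  fixes T :: "complex \<Rightarrow> complex ^ 'n ^ 'n" and u :: "'m::finite \<Rightarrow> complex ^ 'n"
  assumes K: "keldysh_decomposition \<Omega> D T \<mu> u w H"
    and nodes: "\<And>j. j \<in> {1..N} \<Longrightarrow> \<xi> j \<in> \<Omega> \<and> invertible (T (\<xi> j))"
    and \<rho>: "\<rho> \<in> \<Omega>" "invertible (T \<rho>)"
    and quad_H: "spectral_norm ((\<Sum>j=1..N. mscale (\<omega> j / (\<xi> j - \<rho>)) (H (\<xi> j))) - H \<rho>) \<le> \<gamma>"
    and quad_F: "spectral_norm ((mat 1 - H \<rho> ** T \<rho>) - filter_nl_sum N \<xi> \<omega> T \<rho>) \<le> \<gamma>"
    and M: "\<And>x. norm (T \<rho> *v x) \<le> M * norm x"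
  defines "R \<equiv> orth_residual (vec.span (range u))"
  shows "norm (filter_nl_sum N \<xi> \<omega> T \<rho> *v v - (v - H \<rho> *v (T \<rho> *v v))) \<le> \<gamma> * norm v"
    and "norm (R (filter_nl_sum N \<xi> \<omega> T \<rho> *v v)) \<le> \<gamma> * ((1 + M) * norm (R v) + norm (T \<rho> *v v))"
proof -
  interpret R: Vector_Spaces.linear "(*s)" "(*s)" R
    unfolding R_def by (rule linear_orth_residual) simp
  define F where "F = filter_nl_sum N \<xi> \<omega> T \<rho>"
  define E where "E = (\<Sum>j=1..N. mscale (\<omega> j / (\<xi> j - \<rho>)) (H (\<xi> j))) - H \<rho>"
  define r where "r = (\<Sum>j=1..N. \<omega> j / (\<xi> j - \<rho>))"
  have le: "norm (A *v x) \<le> \<gamma> * norm x" if "spectral_norm A \<le> \<gamma>"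
    for A :: "complex ^ 'n ^ 'n" and x
    using norm_matrix_vector_le_spectral_norm[of A x] that
    by (meson mult_right_mono norm_ge_zero order_trans)
  have nR: "norm (R x) \<le> norm x" for x
    unfolding R_def by (rule norm_orth_residual_le) simp
  have FG: "norm (F *v x - (x - H \<rho> *v (T \<rho> *v x))) \<le> \<gamma> * norm x" for x
    using le[OF quad_F, of x]
    by (simp add: F_def matrix_vector_mult_diff_rdistrib matrix_vector_mul_assoc norm_minus_commute)
  then show "norm (filter_nl_sum N \<xi> \<omega> T \<rho> *v v - (v - H \<rho> *v (T \<rho> *v v))) \<le> \<gamma> * norm v"
    by (simp add: F_def)
  have RG: "R (x - H \<rho> *v (T \<rho> *v x)) = 0" for x
  proof -
    have "R (H \<rho> *v (T \<rho> *v x)) = R (matrix_inv (T \<rho>) *v (T \<rho> *v x))"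
      unfolding R_def using keldysh_residual[OF K \<rho>] by simp
    also have "\<dots> = R x" by (simp add: matrix_vector_mul_assoc matrix_inv_inverse[OF \<rho>(2)])
    finally show ?thesis by (simp add: R.diff)
  qed
  have RF: "R (F *v x) = (r - 1) *s R x - R (E *v (T \<rho> *v x))" for x
  proof -
    have "R (F *v x) = r *s R x - R (E *v (T \<rho> *v x)) - R (H \<rho> *v (T \<rho> *v x))"
      using residual_filter_sum[OF K nodes, where \<omega> = \<omega> and \<rho> = \<rho> and v = x]
      by (simp add: F_def E_def r_def R_def[symmetric] matrix_vector_mult_diff_rdistrib R.diff)
    also have "R (H \<rho> *v (T \<rho> *v x)) = R x" using RG[of x] by (simp add: R.diff)
    finally show ?thesis by (simp add: vec.scale_left_diff_distrib)
  qed
  \<comment> \<open>\<open>R v\<close> itself is the test vector on which \<open>r - 1\<close> is measured.\<close>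
  have idem: "R (R v) = R v"
    unfolding R_def by (simp add: orth_residual_def[of _ v] R.diff[unfolded R_def]
        orth_residual_eq_0 orth_proj_mem)
  have \<gamma>: "\<gamma> \<ge> 0"
  proof -
    have "0 \<le> norm (E *v axis undefined 1)" by simp
    also have "\<dots> \<le> \<gamma> * norm (axis undefined 1 :: complex ^ 'n)" using le quad_H E_def by blast
    finally show ?thesis by simp
  qed
  have "norm ((r - 1) *s R v) \<le> \<gamma> * norm (R v) + \<gamma> * (M * norm (R v))"
  proof -
    have "(r - 1) *s R v = R (F *v R v - (R v - H \<rho> *v (T \<rho> *v R v))) + R (E *v (T \<rho> *v R v))"
      unfolding R.diff[of "F *v R v"] RG RF[of "R v"] idem by simp
    also have "norm \<dots> \<le> norm (F *v R v - (R v - H \<rho> *v (T \<rho> *v R v))) + norm (E *v (T \<rho> *v R v))"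
      by (intro order_trans[OF norm_triangle_ineq] add_mono nR)
    also have "\<dots> \<le> \<gamma> * norm (R v) + \<gamma> * norm (T \<rho> *v R v)"
      using quad_H by (intro add_mono FG le) (simp add: E_def)
    also have "\<dots> \<le> \<gamma> * norm (R v) + \<gamma> * (M * norm (R v))"
      using \<gamma> M by (intro add_left_mono mult_left_mono) auto
    finally show ?thesis .
  qed
  moreover have "norm (R (E *v (T \<rho> *v v))) \<le> \<gamma> * norm (T \<rho> *v v)"
    using quad_H by (intro order_trans[OF nR] le) (simp add: E_def)
  ultimately have "norm (R (F *v v)) \<le> \<gamma> * norm (R v) + \<gamma> * (M * norm (R v)) + \<gamma> * norm (T \<rho> *v v)"
    unfolding RF using norm_triangle_ineq4[of "(r - 1) *s R v" "R (E *v (T \<rho> *v v))"] by linarith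
  then show "norm (R (filter_nl_sum N \<xi> \<omega> T \<rho> *v v)) \<le> \<gamma> * ((1 + M) * norm (R v) + norm (T \<rho> *v v))"
    by (simp add: F_def algebra_simps)
qed

text \<open>Nodes and eigenvalues are isolated and both sides are continuous, so the estimates survive at the
  excluded points, in particular at a Ritz value that is an exact eigenvalue.\<close>
lemma filter_nl_estimates:
  fixes T :: "complex \<Rightarrow> complex ^ 'n ^ 'n" and u :: "'m::finite \<Rightarrow> complex ^ 'n"
  assumes K: "keldysh_decomposition \<Omega> D T \<mu> u w H"
    and \<Omega>: "open \<Omega>" "matrix_holomorphic_on T \<Omega>"
    and nodes: "\<And>j. j \<in> {1..N} \<Longrightarrow> \<xi> j \<in> \<Omega> \<and> invertible (T (\<xi> j))"
    and V: "open V" "V \<subseteq> \<Omega>" "V \<subseteq> D" and P: "finite P"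
    and inv: "\<And>\<rho>. \<rho> \<in> V - P \<Longrightarrow> invertible (T \<rho>)"
    and quad_H: "\<And>\<rho>. \<rho> \<in> V \<Longrightarrow>
       spectral_norm ((\<Sum>j=1..N. mscale (\<omega> j / (\<xi> j - \<rho>)) (H (\<xi> j))) - H \<rho>) \<le> \<gamma>"
    and quad_F: "\<And>\<rho>. \<rho> \<in> V - P \<Longrightarrow>
       spectral_norm ((mat 1 - H \<rho> ** T \<rho>) - filter_nl N \<xi> \<omega> T \<rho>) \<le> \<gamma>"
    and M: "\<And>\<rho> x. \<rho> \<in> V \<Longrightarrow> norm (T \<rho> *v x) \<le> M * norm x"
    and \<rho>\<^sub>0: "\<rho>\<^sub>0 \<in> V"
  defines "R \<equiv> orth_residual (vec.span (range u))"
  shows "norm (filter_nl N \<xi> \<omega> T \<rho>\<^sub>0 *v v - (v - H \<rho>\<^sub>0 *v (T \<rho>\<^sub>0 *v v))) \<le> \<gamma> * norm v"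
    and "norm (R (filter_nl N \<xi> \<omega> T \<rho>\<^sub>0 *v v)) \<le> \<gamma> * ((1 + M) * norm (R v) + norm (T \<rho>\<^sub>0 *v v))"
proof -
  let ?Q = "P \<union> \<xi> ` {1..N}"
  let ?F = "\<lambda>\<rho>. filter_nl_sum N \<xi> \<omega> T \<rho> *v v"
  have "finite ?Q" using P by simp
  then have "open (V - (?Q - {\<rho>\<^sub>0}))" by (intro open_Diff V(1) finite_imp_closed) simp
  then have "\<forall>\<^sub>F \<rho> in at \<rho>\<^sub>0. \<rho> \<in> V - (?Q - {\<rho>\<^sub>0})"
    by (rule eventually_at_in_open') (use \<rho>\<^sub>0 in simp)
  then have ev: "\<forall>\<^sub>F \<rho> in at \<rho>\<^sub>0. \<rho> \<in> V - ?Q"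
    using eventually_neq_at_within[of \<rho>\<^sub>0 \<rho>\<^sub>0 UNIV] by eventually_elim auto
  have good: "norm (?F \<rho> - (v - H \<rho> *v (T \<rho> *v v))) \<le> \<gamma> * norm v"
      "norm (R (?F \<rho>)) \<le> \<gamma> * ((1 + M) * norm (R v) + norm (T \<rho> *v v))" if \<rho>: "\<rho> \<in> V - ?Q" for \<rho>
  proof -
    have F: "filter_nl N \<xi> \<omega> T \<rho> = filter_nl_sum N \<xi> \<omega> T \<rho>" using \<rho> by (simp add: filter_nl_def)
    have prems: "\<rho> \<in> \<Omega>" "invertible (T \<rho>)"
      "spectral_norm ((\<Sum>j=1..N. mscale (\<omega> j / (\<xi> j - \<rho>)) (H (\<xi> j))) - H \<rho>) \<le> \<gamma>"
      "spectral_norm ((mat 1 - H \<rho> ** T \<rho>) - filter_nl_sum N \<xi> \<omega> T \<rho>) \<le> \<gamma>"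
      using \<rho> V inv quad_H quad_F[of \<rho>] F by auto
    show "norm (?F \<rho> - (v - H \<rho> *v (T \<rho> *v v))) \<le> \<gamma> * norm v"
      using filter_sum_estimates(1)[OF K nodes prems M] \<rho> by blast
    show "norm (R (?F \<rho>)) \<le> \<gamma> * ((1 + M) * norm (R v) + norm (T \<rho> *v v))"
      unfolding R_def using filter_sum_estimates(2)[OF K nodes prems M] \<rho> by blast
  qed
  have lF: "(?F \<longlongrightarrow> filter_nl N \<xi> \<omega> T \<rho>\<^sub>0 *v v) (at \<rho>\<^sub>0)"
    using nodes \<rho>\<^sub>0 V by (intro tendsto_matrix_vector tendsto_filter_nl[OF \<Omega>]) auto
  have "matrix_holomorphic_on T V" "matrix_holomorphic_on H V"
    using \<Omega>(2) V K unfolding keldysh_decomposition_def matrix_holomorphic_on_def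
    by (meson holomorphic_on_subset)+
  then have "matrix_holomorphic_on (\<lambda>\<rho>. H \<rho> ** T \<rho>) V"
    unfolding matrix_holomorphic_on_def matrix_mult_entry by (intro allI holomorphic_intros) auto
  then have lHT: "((\<lambda>\<rho>. H \<rho> *v (T \<rho> *v v)) \<longlongrightarrow> H \<rho>\<^sub>0 *v (T \<rho>\<^sub>0 *v v)) (at \<rho>\<^sub>0)"
    unfolding matrix_vector_mul_assoc by (rule isCont_matrix_vector[OF _ V(1) \<rho>\<^sub>0])
  have lT: "((\<lambda>\<rho>. T \<rho> *v v) \<longlongrightarrow> T \<rho>\<^sub>0 *v v) (at \<rho>\<^sub>0)"
    by (rule isCont_matrix_vector[OF \<open>matrix_holomorphic_on T V\<close> V(1) \<rho>\<^sub>0])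
  have lR: "((\<lambda>\<rho>. R (?F \<rho>)) \<longlongrightarrow> R (filter_nl N \<xi> \<omega> T \<rho>\<^sub>0 *v v)) (at \<rho>\<^sub>0)"
    unfolding R_def by (rule bounded_linear.tendsto[OF bounded_linear_orth_residual lF]) simp
  show "norm (filter_nl N \<xi> \<omega> T \<rho>\<^sub>0 *v v - (v - H \<rho>\<^sub>0 *v (T \<rho>\<^sub>0 *v v))) \<le> \<gamma> * norm v"
  proof (rule tendsto_upperbound)
    show "((\<lambda>\<rho>. norm (?F \<rho> - (v - H \<rho> *v (T \<rho> *v v)))) \<longlongrightarrow>
        norm (filter_nl N \<xi> \<omega> T \<rho>\<^sub>0 *v v - (v - H \<rho>\<^sub>0 *v (T \<rho>\<^sub>0 *v v)))) (at \<rho>\<^sub>0)"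
      by (intro tendsto_intros lF lHT)
    show "\<forall>\<^sub>F \<rho> in at \<rho>\<^sub>0. norm (?F \<rho> - (v - H \<rho> *v (T \<rho> *v v))) \<le> \<gamma> * norm v"
      using ev by (rule eventually_mono) (rule good(1))
  qed simp
  show "norm (R (filter_nl N \<xi> \<omega> T \<rho>\<^sub>0 *v v)) \<le> \<gamma> * ((1 + M) * norm (R v) + norm (T \<rho>\<^sub>0 *v v))"
  proof (rule tendsto_le)
    show "((\<lambda>\<rho>. norm (R (?F \<rho>))) \<longlongrightarrow> norm (R (filter_nl N \<xi> \<omega> T \<rho>\<^sub>0 *v v))) (at \<rho>\<^sub>0)"
      by (intro tendsto_intros lR)
    show "((\<lambda>\<rho>. \<gamma> * ((1 + M) * norm (R v) + norm (T \<rho> *v v))) \<longlongrightarrow>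
        \<gamma> * ((1 + M) * norm (R v) + norm (T \<rho>\<^sub>0 *v v))) (at \<rho>\<^sub>0)"
      by (intro tendsto_intros lT)
    show "\<forall>\<^sub>F \<rho> in at \<rho>\<^sub>0. norm (R (?F \<rho>)) \<le> \<gamma> * ((1 + M) * norm (R v) + norm (T \<rho> *v v))"
      using ev by (rule eventually_mono) (rule good(2))
  qed simp
qed


section \<open>Angles of perturbed eigenspaces\<close>

lemma independent_columns_lower_bound:
  fixes u :: "'m::finite \<Rightarrow> complex ^ 'n"
  assumes "inj u" "vec.independent (range u)"
  obtains \<sigma> where "\<sigma> > 0" "\<And>c. \<sigma> * norm c \<le> norm (of_columns u *v c)"
proof -
  have "c = 0" if "of_columns u *v c = 0" for c
  proof -
    have "(\<Sum>v\<in>range u. c $ (inv u v) *s v) = (\<Sum>i\<in>UNIV. c $ i *s u i)"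
      using assms(1) by (simp add: sum.reindex)
    also have "\<dots> = 0" using that by (simp add: of_columns_mult)
    finally have "c $ inv u (u i) = 0" for i
      using vec.independentD[OF assms(2), of "range u" "\<lambda>v. c $ inv u v" "u i"] by simp
    then show ?thesis using assms(1) by (simp add: vec_eq_iff)
  qed
  then have "inj ((*v) (of_columns u))"
    using linear_injective_0[OF linear_matrix_vector] by blast
  then show ?thesis using linear_inj_bounded_below_pos[OF linear_matrix_vector] that by blast
qed

lemma columns_of_columns: "columns (of_columns z) = range z"
  by (auto simp: columns_def column_def of_columns_def)

lemma range_matrix_vector_eq_span_columns:
  "range ((*v) A) = vec.span (columns (A :: complex ^ 'm ^ 'n))"
proof
  show "range ((*v) A) \<subseteq> vec.span (columns A)"
  proof (rule image_subsetI)
    show "A *v x \<in> vec.span (columns A)" for x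
      unfolding matrix_mult_sum by (intro vec.span_sum vec.span_scale vec.span_base) (auto simp: columns_def)
  qed
  have "column j A \<in> range ((*v) A)" for j
    using rangeI[of "(*v) A" "axis j 1"] by (simp only: matrix_vector_mult_axis)
  then have "columns A \<subseteq> range ((*v) A)" by (auto simp: columns_def)
  moreover have "vec.subspace (range ((*v) A))"
    by (rule vec.subspace_image) (rule vec.subspace_UNIV)
  ultimately show "vec.span (columns A) \<subseteq> range ((*v) A)" by (rule vec.span_minimal)
qed

lemma dim_span_columns:
  fixes A :: "complex ^ 'm ^ 'n"
  assumes "inj ((*v) A)"
  shows "vec.dim (vec.span (columns A)) = CARD('m)"
proof -
  have "vec.dim ((*v) A ` UNIV) = vec.dim (UNIV :: (complex ^ 'm) set)"
    using assms by (intro vec.dim_image_eq matrix_vector_mul_linear_gen) simp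
  then show ?thesis
    unfolding range_matrix_vector_eq_span_columns[symmetric] by (simp add: card_cart_basis)
qed

lemma inj_orthonormal_basis_matrix:
  assumes "orthonormal_basis_matrix Q X"
  shows "inj ((*v) Q)"
proof (rule inj_on_inverseI)
  show "ctranspose Q *v (Q *v x) = x" for x
    using assms by (simp add: orthonormal_basis_matrix_def matrix_vector_mul_assoc)
qed

lemma ritz_vector_nonzero:
  fixes x :: "'m::finite \<Rightarrow> complex ^ 'n"
  assumes "ritz_pairs D T X \<rho> x"
  shows "x i \<noteq> 0"
proof -
  obtain Q :: "complex ^ 'm ^ 'n" where Q: "orthonormal_basis_matrix Q X"
    and "\<forall>i. \<exists>y. eigenpair (\<lambda>z. ctranspose Q ** T z ** Q) (\<rho> i) y \<and> x i = Q *v y"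
    using assms unfolding ritz_pairs_def by (elim exE conjE)
  then obtain y where y: "eigenpair (\<lambda>z. ctranspose Q ** T z ** Q) (\<rho> i) y" "x i = Q *v y"
    by blast
  have "Q *v y \<noteq> Q *v 0"
    using y(1) inj_orthonormal_basis_matrix[OF Q] unfolding eigenpair_def by (metis injD)
  then show ?thesis using y(2) by simp
qed

text \<open>A perturbation of half the lower bound \<open>\<sigma>\<close> keeps the family a basis with lower bound \<open>\<sigma> / 2\<close>, so
  residuals of the basis vectors control those of all linear combinations.\<close>
lemma perturbed_span:
  fixes u z :: "'m::finite \<Rightarrow> complex ^ 'n"
  assumes \<sigma>: "\<sigma> > 0" "\<And>c. \<sigma> * norm c \<le> norm (of_columns u *v c)"
    and close: "\<And>i. norm (z i - u i) \<le> \<sigma> / (2 * real CARD('m))"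
    and res: "\<And>i. norm (orth_residual (vec.span (range u)) (z i)) \<le> \<tau>"
  shows "vec.dim (vec.span (range z)) = CARD('m)"
    and "subspace_angle (vec.span (range z)) (vec.span (range u)) \<le> 4 * real CARD('m) / \<sigma> * \<tau>"
proof -
  let ?U = "vec.span (range u)" and ?m = "real CARD('m)"
  interpret R: Vector_Spaces.linear "(*s)" "(*s)" "orth_residual ?U"
    by (rule linear_orth_residual) simp
  have sum_le: "norm (\<Sum>i\<in>UNIV. c $ i *s y i) \<le> ?m * (norm c * b)"
    if "\<And>i. norm (y i) \<le> b" for c :: "complex ^ 'm" and y :: "'m \<Rightarrow> complex ^ 'n" and b
  proof -
    have "norm (\<Sum>i\<in>UNIV. c $ i *s y i) \<le> (\<Sum>i\<in>(UNIV::'m set). norm c * b)"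
      using that by (intro sum_norm_le) (simp add: norm_vec_scale mult_mono Finite_Cartesian_Product.norm_nth_le)
    then show ?thesis by simp
  qed
  have m: "?m > 0" by simp
  have lower: "\<sigma> / 2 * norm c \<le> norm (of_columns z *v c)" for c
  proof -
    have "of_columns u *v c = of_columns z *v c - (\<Sum>i\<in>UNIV. c $ i *s (z i - u i))"
      by (simp add: of_columns_mult vec.scale_right_diff_distrib sum_subtractf)
    then have "norm (of_columns u *v c) \<le> norm (of_columns z *v c) + norm (\<Sum>i\<in>UNIV. c $ i *s (z i - u i))"
      by (simp add: norm_triangle_ineq4)
    also have "norm (\<Sum>i\<in>UNIV. c $ i *s (z i - u i)) \<le> ?m * (norm c * (\<sigma> / (2 * ?m)))"
      by (rule sum_le[OF close])
    also have "\<dots> = \<sigma> / 2 * norm c" using m by (simp add: field_simps)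
    finally show ?thesis using \<sigma>(2)[of c] by simp
  qed
  have "inj ((*v) (of_columns z))"
  proof -
    have "c = 0" if "of_columns z *v c = 0" for c
      using lower[of c] that \<sigma>(1) by (simp add: mult_le_0_iff)
    then show ?thesis using linear_injective_0[OF linear_matrix_vector] by blast
  qed
  from dim_span_columns[OF this] show dz: "vec.dim (vec.span (range z)) = CARD('m)"
    by (simp only: columns_of_columns)
  have "inj ((*v) (of_columns u))"
  proof -
    have "c = 0" if "of_columns u *v c = 0" for c
      using \<sigma>(2)[of c] that \<sigma>(1) by (simp add: mult_le_0_iff)
    then show ?thesis using linear_injective_0[OF linear_matrix_vector] by blast
  qed
  from dim_span_columns[OF this] have du: "vec.dim ?U = CARD('m)"
    by (simp only: columns_of_columns)
  have \<tau>: "\<tau> \<ge> 0" using res norm_ge_zero order_trans by blast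
  have "subspace_angle (vec.span (range z)) ?U \<le> 2 * (2 * ?m / \<sigma> * \<tau>)"
  proof (rule subspace_angle_le)
    fix x assume "x \<in> vec.span (range z)"
    then obtain c where x: "x = of_columns z *v c"
      using range_matrix_vector_eq_span_columns[of "of_columns z"] unfolding columns_of_columns by blast
    have "norm (orth_residual ?U x) = norm (\<Sum>i\<in>UNIV. c $ i *s orth_residual ?U (z i))"
      by (simp add: x of_columns_mult R.sum R.scale)
    also have "\<dots> \<le> ?m * (norm c * \<tau>)" by (rule sum_le[OF res])
    also have "\<dots> = 2 * ?m / \<sigma> * \<tau> * (\<sigma> / 2 * norm c)" using \<sigma>(1) by (simp add: field_simps)
    also have "\<dots> \<le> 2 * ?m / \<sigma> * \<tau> * norm x"
      using lower[of c] \<sigma>(1) \<tau> x by (intro mult_left_mono) auto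
    finally show "norm (x - orth_proj ?U x) \<le> 2 * ?m / \<sigma> * \<tau> * norm x"
      by (simp add: orth_residual_def)
  qed (simp_all only: dz du vec.subspace_span, simp)
  then show "subspace_angle (vec.span (range z)) ?U \<le> 4 * ?m / \<sigma> * \<tau>" by simp
qed

lemma dim_span_singleton:
  fixes x :: "complex ^ 'n"
  assumes "x \<noteq> 0"
  shows "vec.dim (vec.span {x}) = 1"
proof -
  have "vec.independent {x}" using assms by (simp add: vec.dependent_single)
  then show ?thesis by (simp add: vec.dim_span_eq_card_independent)
qed

text \<open>A Ritz vector is determined only up to a scalar; the projection of \<open>u\<close> onto its line chooses a scalar
  for which the vectors themselves are close.\<close>
lemma align_to_unit_vector:
  fixes x u :: "complex ^ 'n"
  assumes x: "x \<noteq> 0" and u: "norm u = 1"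
    and angle: "subspace_angle (vec.span {x}) (vec.span {u}) \<le> \<alpha>" and \<alpha>: "\<alpha> < 1"
  obtains a where "a \<noteq> 0" "norm (a *s x - u) \<le> \<alpha>"
proof -
  have "u \<noteq> 0" using u by auto
  have "norm (u - orth_proj (vec.span {x}) u) \<le> subspace_angle (vec.span {u}) (vec.span {x}) * norm u"
    by (intro residual_le_subspace_angle)
      (simp_all only: vec.subspace_span dim_span_singleton x \<open>u \<noteq> 0\<close> not_False_eq_True vec.span_base insertI1)
  also have "\<dots> \<le> \<alpha>" using angle u by (simp add: subspace_angle_commute)
  finally have le: "norm (u - orth_proj (vec.span {x}) u) \<le> \<alpha>" .
  have "orth_proj (vec.span {x}) u \<in> vec.span {x}" by (simp only: orth_proj_mem vec.subspace_span)
  then obtain a where a: "orth_proj (vec.span {x}) u = a *s x" by (auto simp: vec.span_singleton)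
  have "a \<noteq> 0" using le u \<alpha> a by auto
  then show ?thesis using that le a by (simp add: norm_minus_commute)
qed

lemma span_range_scale:
  fixes x :: "'m \<Rightarrow> complex ^ 'n"
  assumes "\<And>i. a i \<noteq> 0"
  shows "vec.span (range (\<lambda>i. a i *s x i)) = vec.span (range x)"
proof
  show "vec.span (range (\<lambda>i. a i *s x i)) \<subseteq> vec.span (range x)"
    by (intro vec.span_minimal) (auto intro: vec.span_scale vec.span_base)
  have "x i \<in> vec.span (range (\<lambda>i. a i *s x i))" for i
  proof -
    have "inverse (a i) *s (a i *s x i) \<in> vec.span (range (\<lambda>i. a i *s x i))"
      by (intro vec.span_scale vec.span_base) simp
    then show ?thesis using assms by simp
  qed
  then show "vec.span (range x) \<subseteq> vec.span (range (\<lambda>i. a i *s x i))"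
    by (intro vec.span_minimal) auto
qed

text \<open>One step with all constants explicit.  The hypothesis \<open>small\<close> keeps the filtered vectors within half
  the basis bound of the eigenvectors, while their residuals carry the product \<open>\<gamma> * \<alpha>\<close>.\<close>
lemma filtered_span_contraction:
  fixes T H F :: "complex \<Rightarrow> complex ^ 'n ^ 'n" and u x :: "'m::finite \<Rightarrow> complex ^ 'n"
  defines "R \<equiv> orth_residual (vec.span (range u))"
  assumes \<sigma>: "\<sigma> > 0" "\<And>c. \<sigma> * norm c \<le> norm (of_columns u *v c)"
    and u: "\<And>i. norm (u i) = 1" and x: "\<And>i. x i \<noteq> 0"
    and near: "\<And>i. \<rho> i \<in> V" "\<And>i. cmod (\<rho> i - \<mu> i) \<le> \<alpha>"
      "\<And>i. subspace_angle (vec.span {x i}) (vec.span {u i}) \<le> \<alpha>"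
    and T_bound: "\<And>z y. z \<in> V \<Longrightarrow> norm (T z *v y) \<le> M * norm y"
    and H_bound: "\<And>z y. z \<in> V \<Longrightarrow> norm (H z *v y) \<le> M' * norm y"
    and T_lip: "\<And>i. norm (T (\<rho> i) *v u i) \<le> L * cmod (\<rho> i - \<mu> i)"
    and const: "0 \<le> M" "0 \<le> M'" "0 \<le> L" "\<gamma> \<ge> 0"
    and F_near: "\<And>z v. z \<in> V \<Longrightarrow> norm (F z *v v - (v - H z *v (T z *v v))) \<le> \<gamma> * norm v"
    and F_res: "\<And>z v. z \<in> V \<Longrightarrow>
        norm (R (F z *v v)) \<le> \<gamma> * ((1 + M) * norm (R v) + norm (T z *v v))"
    and \<alpha>: "\<alpha> < 1"
    and small: "2 * \<gamma> + (1 + M' * (M + L)) * \<alpha> \<le> \<sigma> / (2 * real CARD('m))"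
  shows "vec.dim (vec.span (range (\<lambda>i. F (\<rho> i) *v x i))) = CARD('m)"
    and "subspace_angle (vec.span (range (\<lambda>i. F (\<rho> i) *v x i))) (vec.span (range u))
      \<le> 4 * real CARD('m) / \<sigma> * (\<gamma> * ((1 + 2 * M + L) * \<alpha>))"
proof -
  have "\<exists>a. a \<noteq> 0 \<and> norm (a *s x i - u i) \<le> \<alpha>" for i
    using align_to_unit_vector[OF x u near(3) \<alpha>] by metis
  then obtain a where a: "\<And>i. a i \<noteq> 0" "\<And>i. norm (a i *s x i - u i) \<le> \<alpha>" by metis
  define v where "v i = a i *s x i" for i
  have vu: "norm (v i - u i) \<le> \<alpha>" for i using a(2) by (simp add: v_def)
  have v2: "norm (v i) \<le> 2" for i
    using norm_triangle_ineq[of "v i - u i" "u i"] vu[of i] u[of i] \<alpha> by simp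
  have Tv: "norm (T (\<rho> i) *v v i) \<le> (M + L) * \<alpha>" for i
  proof -
    have "T (\<rho> i) *v v i = T (\<rho> i) *v (v i - u i) + T (\<rho> i) *v u i"
      by (simp add: matrix_vector_mult_diff_distrib)
    then have "norm (T (\<rho> i) *v v i) \<le> norm (T (\<rho> i) *v (v i - u i)) + norm (T (\<rho> i) *v u i)"
      by (simp only: norm_triangle_ineq)
    also have "\<dots> \<le> M * \<alpha> + L * \<alpha>"
      using const near(2) vu
      by (intro add_mono order_trans[OF T_bound[OF near(1)]] order_trans[OF T_lip] mult_left_mono) auto
    finally show ?thesis by (simp add: algebra_simps)
  qed
  define z where "z i = F (\<rho> i) *v v i" for i
  have close: "norm (z i - u i) \<le> \<sigma> / (2 * real CARD('m))" for i
  proof -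
    let ?e = "z i - (v i - H (\<rho> i) *v (T (\<rho> i) *v v i))"
    have "z i - u i = (?e + (v i - u i)) - H (\<rho> i) *v (T (\<rho> i) *v v i)" by simp
    also have "norm \<dots> \<le> (norm ?e + norm (v i - u i)) + norm (H (\<rho> i) *v (T (\<rho> i) *v v i))"
      by (rule order_trans[OF norm_triangle_ineq4 add_right_mono[OF norm_triangle_ineq]])
    also have "\<dots> \<le> (\<gamma> * 2 + \<alpha>) + M' * ((M + L) * \<alpha>)"
      unfolding z_def using const v2
      by (intro add_mono vu order_trans[OF F_near[OF near(1)]] order_trans[OF H_bound[OF near(1)]]
          mult_left_mono Tv) auto
    also have "\<dots> \<le> \<sigma> / (2 * real CARD('m))" using small by (simp add: algebra_simps)
    finally show ?thesis .
  qed
  have res: "norm (R (z i)) \<le> \<gamma> * ((1 + 2 * M + L) * \<alpha>)" for i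
  proof -
    have "norm (R (v i)) \<le> \<alpha>"
      unfolding R_def
      by (rule order_trans[OF norm_orth_residual_le_dist vu[of i]])
        (simp_all only: vec.subspace_span vec.span_base rangeI)
    then have "(1 + M) * norm (R (v i)) + norm (T (\<rho> i) *v v i) \<le> (1 + M) * \<alpha> + (M + L) * \<alpha>"
      using const by (intro add_mono mult_left_mono Tv) auto
    also have "\<dots> = (1 + 2 * M + L) * \<alpha>" by (simp add: algebra_simps)
    finally show ?thesis
      unfolding z_def by (rule order_trans[OF F_res[OF near(1)] mult_left_mono[OF _ const(4)]])
  qed
  have "z = (\<lambda>i. a i *s (F (\<rho> i) *v x i))" by (simp add: fun_eq_iff z_def v_def vec.scale)
  then have span: "vec.span (range z) = vec.span (range (\<lambda>i. F (\<rho> i) *v x i))"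
    using span_range_scale[of a, OF a(1)] by simp
  show "vec.dim (vec.span (range (\<lambda>i. F (\<rho> i) *v x i))) = CARD('m)"
    using perturbed_span(1)[OF \<sigma> close res[unfolded R_def]] unfolding span .
  show "subspace_angle (vec.span (range (\<lambda>i. F (\<rho> i) *v x i))) (vec.span (range u))
      \<le> 4 * real CARD('m) / \<sigma> * (\<gamma> * ((1 + 2 * M + L) * \<alpha>))"
    using perturbed_span(2)[OF \<sigma> close res[unfolded R_def]] unfolding span .
qed

lemma matrix_bound_on_compact:
  assumes "compact K" "K \<subseteq> S" "matrix_holomorphic_on A S"
  obtains M where "M \<ge> 0" "\<And>z y. z \<in> K \<Longrightarrow> norm (A z *v y) \<le> M * norm y"
proof -
  have "continuous_on K (\<lambda>z. \<Sum>i\<in>UNIV. \<Sum>j\<in>UNIV. cmod (A z $ i $ j))"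
    using assms unfolding matrix_holomorphic_on_def
    by (intro continuous_on_sum continuous_on_norm) (meson holomorphic_on_imp_continuous_on continuous_on_subset)
  then have "bounded ((\<lambda>z. \<Sum>i\<in>UNIV. \<Sum>j\<in>UNIV. cmod (A z $ i $ j)) ` K)"
    using assms(1) compact_continuous_image compact_imp_bounded by blast
  then obtain M where M: "M > 0" "\<And>z. z \<in> K \<Longrightarrow> norm (\<Sum>i\<in>UNIV. \<Sum>j\<in>UNIV. cmod (A z $ i $ j)) \<le> M"
    unfolding bounded_pos by blast
  have "norm (A z *v y) \<le> M * norm y" if "z \<in> K" for z y
  proof (rule order_trans[OF norm_matrix_vector_le_sum mult_right_mono])
    show "(\<Sum>i\<in>UNIV. \<Sum>j\<in>UNIV. cmod (A z $ i $ j)) \<le> M"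
      using M(2)[OF that] by simp
  qed simp
  then show ?thesis using that[of M] M(1) by simp
qed

lemma holomorphic_linear_bound_at_zero:
  assumes "f holomorphic_on S" "open S" "\<mu> \<in> S" "f \<mu> = 0"
  shows "\<exists>L\<ge>0. \<forall>\<^sub>F z in nhds \<mu>. cmod (f z) \<le> L * cmod (z - \<mu>)"
proof -
  obtain d where "(f has_field_derivative d) (at \<mu>)"
    using assms by (metis field_differentiable_def holomorphic_on_imp_differentiable_at)
  then have "((\<lambda>z. cmod ((f z - f \<mu>) / (z - \<mu>))) \<longlongrightarrow> cmod d) (at \<mu>)"
    by (intro tendsto_norm) (simp add: has_field_derivative_iff)
  then have "\<forall>\<^sub>F z in at \<mu>. cmod ((f z - f \<mu>) / (z - \<mu>)) < cmod d + 1"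
    by (rule order_tendstoD) simp
  then have "\<forall>\<^sub>F z in at \<mu>. cmod (f z) \<le> (cmod d + 1) * cmod (z - \<mu>)"
    using eventually_neq_at_within[of \<mu> \<mu> UNIV]
    by eventually_elim (use assms(4) in \<open>simp add: norm_divide divide_simps\<close>)
  then have "\<forall>\<^sub>F z in nhds \<mu>. cmod (f z) \<le> (cmod d + 1) * cmod (z - \<mu>)"
    using assms(4) by (auto simp: eventually_at_filter elim: eventually_mono)
  then show ?thesis by (intro exI[of _ "cmod d + 1"]) auto
qed

text \<open>\<open>T z\<close> annihilates \<open>u i\<close> at the eigenvalue and therefore is of first order in the distance to it.\<close>
lemma eigenvector_linear_bound:
  fixes T :: "complex \<Rightarrow> complex ^ 'n ^ 'n" and u :: "'m::finite \<Rightarrow> complex ^ 'n"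
  assumes "matrix_holomorphic_on T \<Omega>" "open \<Omega>" "\<And>i. \<mu> i \<in> \<Omega>" "\<And>i. T (\<mu> i) *v u i = 0"
  obtains L r where "L \<ge> 0" "r > 0"
    "\<And>i z. cmod (z - \<mu> i) < r \<Longrightarrow> norm (T z *v u i) \<le> L * cmod (z - \<mu> i)"
proof -
  have "\<exists>L\<ge>0. \<forall>\<^sub>F z in nhds (\<mu> i). cmod ((T z *v u i) $ a) \<le> L * cmod (z - \<mu> i)" for i a
  proof (rule holomorphic_linear_bound_at_zero[OF _ assms(2) assms(3)])
    show "(\<lambda>z. (T z *v u i) $ a) holomorphic_on \<Omega>"
      using assms(1) unfolding matrix_vector_mult_def matrix_holomorphic_on_def
      by (auto intro!: holomorphic_intros)
  qed (simp add: assms(4))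
  then have "\<forall>i. \<forall>a. \<exists>L. L \<ge> 0 \<and> (\<forall>\<^sub>F z in nhds (\<mu> i). cmod ((T z *v u i) $ a) \<le> L * cmod (z - \<mu> i))"
    by blast
  then obtain l where "\<forall>i. \<forall>a. l i a \<ge> 0 \<and>
      (\<forall>\<^sub>F z in nhds (\<mu> i). cmod ((T z *v u i) $ a) \<le> l i a * cmod (z - \<mu> i))"
    unfolding choice_iff by (elim exE)
  then have l: "l i a \<ge> 0"
    "\<forall>\<^sub>F z in nhds (\<mu> i). cmod ((T z *v u i) $ a) \<le> l i a * cmod (z - \<mu> i)" for i a
    by auto
  have "\<exists>r>0. \<forall>z. dist z (\<mu> i) < r \<longrightarrow> (\<forall>a. cmod ((T z *v u i) $ a) \<le> l i a * cmod (z - \<mu> i))" for i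
    using eventually_all_finite[where P = "\<lambda>z a. cmod ((T z *v u i) $ a) \<le> l i a * cmod (z - \<mu> i)", OF l(2)]
    by (simp add: eventually_nhds_metric)
  then have "\<forall>i. \<exists>r. r > 0 \<and>
      (\<forall>z. dist z (\<mu> i) < r \<longrightarrow> (\<forall>a. cmod ((T z *v u i) $ a) \<le> l i a * cmod (z - \<mu> i)))"
    by blast
  then obtain r where "\<forall>i. r i > 0 \<and>
      (\<forall>z. dist z (\<mu> i) < r i \<longrightarrow> (\<forall>a. cmod ((T z *v u i) $ a) \<le> l i a * cmod (z - \<mu> i)))"
    unfolding choice_iff by (elim exE)
  then have r: "r i > 0"
    "dist z (\<mu> i) < r i \<Longrightarrow> cmod ((T z *v u i) $ a) \<le> l i a * cmod (z - \<mu> i)" for i z a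
    by auto
  show ?thesis
  proof
    show "(\<Sum>i\<in>UNIV. \<Sum>a\<in>UNIV. l i a) \<ge> 0" by (intro sum_nonneg l(1))
    show "Min (range r) > 0" using r(1) by auto
    fix i z assume "cmod (z - \<mu> i) < Min (range r)"
    then have "dist z (\<mu> i) < r i" by (simp add: dist_norm)
    have "norm (T z *v u i) \<le> (\<Sum>a\<in>UNIV. cmod ((T z *v u i) $ a))"
      unfolding norm_vec_def by (rule L2_set_le_sum) simp
    also have "\<dots> \<le> (\<Sum>a\<in>UNIV. l i a * cmod (z - \<mu> i))"
      by (intro sum_mono r(2) \<open>dist z (\<mu> i) < r i\<close>)
    also have "\<dots> = (\<Sum>a\<in>UNIV. l i a) * cmod (z - \<mu> i)" by (simp add: sum_distrib_right)
    also have "\<dots> \<le> (\<Sum>i\<in>UNIV. \<Sum>a\<in>UNIV. l i a) * cmod (z - \<mu> i)"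
      by (intro mult_right_mono member_le_sum sum_nonneg l(1)) auto
    finally show "norm (T z *v u i) \<le> (\<Sum>i\<in>UNIV. \<Sum>a\<in>UNIV. l i a) * cmod (z - \<mu> i)" .
  qed
qed


section \<open>Linear convergence of the iteration\<close>

text \<open>The step must preserve the hypotheses under which it contracts; this is where \<open>q \<le> 1\<close> enters.  The
  same invariant guarantees Ritz pairs in every step, so the iteration can be run.\<close>
lemma nlfeast_linear_convergence:
  fixes T :: "complex \<Rightarrow> complex ^ 'n ^ 'n" and \<U> X\<^sub>0 :: "(complex ^ 'n) set"
    and \<epsilon> q :: real and N :: nat and \<xi> \<omega> :: "nat \<Rightarrow> complex"
  defines "good \<equiv> \<lambda>X. vec.subspace X \<and> vec.dim X = CARD('m::finite) \<and> subspace_angle X \<U> \<le> \<epsilon>"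
  defines "step \<equiv> \<lambda>(\<rho> :: 'm \<Rightarrow> complex) x. vec.span (range (\<lambda>i. filter_nl N \<xi> \<omega> T (\<rho> i) *v x i))"
  assumes \<U>: "vec.subspace \<U>" "vec.dim \<U> = CARD('m)"
    and q: "0 \<le> q" "q \<le> 1"
    and extractable: "\<And>X. good X \<Longrightarrow> \<exists>(\<rho> :: 'm \<Rightarrow> complex) x. ritz_pairs D T X \<rho> x"
    and contract: "\<And>X (\<rho> :: 'm \<Rightarrow> complex) x. good X \<Longrightarrow> ritz_pairs D T X \<rho> x \<Longrightarrow>
      vec.dim (step \<rho> x) = CARD('m) \<and> subspace_angle (step \<rho> x) \<U> \<le> q * subspace_angle X \<U>"
    and start: "good X\<^sub>0"
  shows "\<exists>X (\<rho> :: nat \<Rightarrow> 'm \<Rightarrow> complex) x. X 0 = X\<^sub>0 \<and> nlfeast D T N \<xi> \<omega> X \<rho> x"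
    and "\<And>X (\<rho> :: nat \<Rightarrow> 'm \<Rightarrow> complex) x k. X 0 = X\<^sub>0 \<Longrightarrow> nlfeast D T N \<xi> \<omega> X \<rho> x \<Longrightarrow>
      subspace_angle (X k) \<U> \<le> q ^ k * subspace_angle X\<^sub>0 \<U>"
proof -
  have good_step: "good (step \<rho> x)" if X: "good X" and ritz: "ritz_pairs D T X \<rho> x"
    for X and \<rho> :: "'m \<Rightarrow> complex" and x
  proof -
    have "0 \<le> subspace_angle X \<U>"
      using X \<U> by (intro subspace_angle_nonneg) (auto simp: good_def)
    then have "q * subspace_angle X \<U> \<le> subspace_angle X \<U>"
      using q by (simp add: mult_left_le_one_le)
    moreover have "vec.subspace (step \<rho> x)" unfolding step_def by (rule vec.subspace_span)
    ultimately show ?thesis using contract[OF X ritz] X by (auto simp: good_def)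
  qed
  show "\<exists>X (\<rho> :: nat \<Rightarrow> 'm \<Rightarrow> complex) x. X 0 = X\<^sub>0 \<and> nlfeast D T N \<xi> \<omega> X \<rho> x"
  proof -
    have "\<exists>p :: ('m \<Rightarrow> complex) \<times> ('m \<Rightarrow> complex ^ 'n). good X \<longrightarrow> ritz_pairs D T X (fst p) (snd p)" for X
      using extractable[of X] by fastforce
    then obtain p :: "(complex ^ 'n) set \<Rightarrow> ('m \<Rightarrow> complex) \<times> ('m \<Rightarrow> complex ^ 'n)"
      where p: "\<And>X. good X \<Longrightarrow> ritz_pairs D T X (fst (p X)) (snd (p X))"
      by metis
    \<comment> \<open>The Ritz pairs of each subspace are chosen once by \<open>p\<close>; iteration then is a plain function power.\<close>
    define Xs where "Xs k = ((\<lambda>X. step (fst (p X)) (snd (p X))) ^^ k) X\<^sub>0" for k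
    have X0: "Xs 0 = X\<^sub>0" and XSuc: "Xs (Suc k) = step (fst (p (Xs k))) (snd (p (Xs k)))" for k
      by (simp_all add: Xs_def)
    have good: "good (Xs k)" for k
      by (induction k) (simp_all add: X0 start XSuc good_step p)
    have "nlfeast D T N \<xi> \<omega> Xs (\<lambda>k. fst (p (Xs k))) (\<lambda>k. snd (p (Xs k)))"
      unfolding nlfeast_def using p[OF good] XSuc by (simp add: step_def)
    then show ?thesis using X0 by blast
  qed
  fix X and \<rho> :: "nat \<Rightarrow> 'm \<Rightarrow> complex" and x k
  assume X0: "X 0 = X\<^sub>0" and iter: "nlfeast D T N \<xi> \<omega> X \<rho> x"
  have ritz: "ritz_pairs D T (X k) (\<rho> k) (x k)" and XSuc: "X (Suc k) = step (\<rho> k) (x k)" for k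
    using iter by (simp_all add: nlfeast_def step_def)
  have good: "good (X k)" for k
    by (induction k) (simp_all add: X0 start XSuc good_step[OF _ ritz])
  show "subspace_angle (X k) \<U> \<le> q ^ k * subspace_angle X\<^sub>0 \<U>"
  proof (induction k)
    case 0
    then show ?case by (simp add: X0)
  next
    case (Suc k)
    have "subspace_angle (X (Suc k)) \<U> \<le> q * subspace_angle (X k) \<U>"
      using contract[OF good ritz] by (simp add: XSuc)
    also have "\<dots> \<le> q * (q ^ k * subspace_angle X\<^sub>0 \<U>)" using Suc q by (intro mult_left_mono)
    finally show ?case by simp
  qed
qed

lemma dim_span_independent_family:
  fixes u :: "'m::finite \<Rightarrow> complex ^ 'n"
  assumes "inj u" "vec.independent (range u)"
  shows "vec.dim (vec.span (range u)) = CARD('m)"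
  using vec.dim_span_eq_card_independent[OF assms(2)] card_image[OF assms(1)] by simp

text \<open>The constants are fixed before the quadrature rule.  The first term of \<open>c\<close> is the contraction constant, and
  the second makes \<open>2 * \<gamma>\<close> at most half of the perturbation that the eigenvector basis tolerates.
  The bound \<open>\<epsilon>\<close> keeps the Ritz values in the region of the estimates and spends the other half.\<close>
lemma nlfeast_step_contraction:
  fixes T H :: "complex \<Rightarrow> complex ^ 'n ^ 'n" and \<mu> :: "'m::finite \<Rightarrow> complex"
    and u w :: "'m \<Rightarrow> complex ^ 'n"
  defines "\<U> \<equiv> vec.span (range u)"
  assumes \<Omega>: "open \<Omega>" "matrix_holomorphic_on T \<Omega>" and D: "D \<subseteq> \<Omega>"
    and \<mu>: "range \<mu> = eigenvalues_in D T"
    and u: "\<And>i. T (\<mu> i) *v u i = 0" "\<And>i. norm (u i) = 1"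
    and indep: "inj u" "vec.independent (range u)"
    and K: "keldysh_decomposition \<Omega> D T \<mu> u w H"
    and D0: "compact D\<^sub>0" "D\<^sub>0 \<subseteq> D" "\<And>i. \<mu> i \<in> interior D\<^sub>0"
    and ci: "\<And>\<rho>. \<rho> \<in> D \<Longrightarrow> invertible (T \<rho>) \<Longrightarrow> filter_ci g T \<rho> = mat 1 - H \<rho> ** T \<rho>"
    and extraction: "extraction_assumption D T \<mu> u"
  obtains \<epsilon> c where "\<epsilon> > 0" "c > 0"
    "\<And>X. vec.subspace X \<Longrightarrow> vec.dim X = CARD('m) \<Longrightarrow> subspace_angle X \<U> \<le> \<epsilon> \<Longrightarrow>
      \<exists>(\<rho> :: 'm \<Rightarrow> complex) x. ritz_pairs D T X \<rho> x"
    "\<And>N \<xi> \<omega> \<gamma> X (\<rho> :: 'm \<Rightarrow> complex) x.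
      (\<And>j. j \<in> {1..N} \<Longrightarrow> \<xi> j \<in> \<Omega> \<and> invertible (T (\<xi> j))) \<Longrightarrow> 0 \<le> \<gamma> \<Longrightarrow> \<gamma> < 1 / c \<Longrightarrow>
      (\<And>z. z \<in> D\<^sub>0 \<Longrightarrow>
         spectral_norm ((\<Sum>j=1..N. mscale (\<omega> j / (\<xi> j - z)) (H (\<xi> j))) - H z) \<le> \<gamma> \<and>
         spectral_norm (filter_ci g T z - filter_nl N \<xi> \<omega> T z) \<le> \<gamma>) \<Longrightarrow>
      vec.subspace X \<Longrightarrow> vec.dim X = CARD('m) \<Longrightarrow> subspace_angle X \<U> \<le> \<epsilon> \<Longrightarrow>
      ritz_pairs D T X \<rho> x \<Longrightarrow>
      vec.dim (vec.span (range (\<lambda>i. filter_nl N \<xi> \<omega> T (\<rho> i) *v x i))) = CARD('m) \<and>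
      subspace_angle (vec.span (range (\<lambda>i. filter_nl N \<xi> \<omega> T (\<rho> i) *v x i))) \<U>
        \<le> c * \<gamma> * subspace_angle X \<U>"
proof -
  let ?m = "real CARD('m)"
  define V where "V = interior D\<^sub>0"
  have V: "open V" "V \<subseteq> D\<^sub>0" "V \<subseteq> D" "V \<subseteq> \<Omega>"
    using D0(2) D interior_subset[of D\<^sub>0] by (auto simp: V_def)
  have dim\<U>: "vec.dim \<U> = CARD('m)" unfolding \<U>_def by (rule dim_span_independent_family[OF indep])
  have inv: "invertible (T z)" if "z \<in> V - range \<mu>" for z
    using that \<mu> V(3) invertible_iff_no_eigenvector[of T z] unfolding eigenvalues_in_def by blast
  obtain \<sigma> where \<sigma>: "\<sigma> > 0" "\<And>c. \<sigma> * norm c \<le> norm (of_columns u *v c)"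
    using independent_columns_lower_bound[OF indep] by blast
  obtain M where M: "M \<ge> 0" "\<And>z y. z \<in> D\<^sub>0 \<Longrightarrow> norm (T z *v y) \<le> M * norm y"
    using matrix_bound_on_compact[OF D0(1) order_trans[OF D0(2) D] \<Omega>(2)] by blast
  have "matrix_holomorphic_on H D" using K by (simp add: keldysh_decomposition_def)
  then obtain M' where M': "M' \<ge> 0" "\<And>z y. z \<in> D\<^sub>0 \<Longrightarrow> norm (H z *v y) \<le> M' * norm y"
    using matrix_bound_on_compact[OF D0(1,2)] by blast
  have \<mu>\<Omega>: "\<mu> i \<in> \<Omega>" for i using D0(3) V by (auto simp: V_def)
  then obtain L r1 where L: "L \<ge> 0" "r1 > 0"
    "\<And>i z. cmod (z - \<mu> i) < r1 \<Longrightarrow> norm (T z *v u i) \<le> L * cmod (z - \<mu> i)"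
    using eigenvector_linear_bound[of T \<Omega> \<mu> u, OF \<Omega>(2,1) \<mu>\<Omega> u(1)] by blast
  have "compact (range \<mu>)" "range \<mu> \<subseteq> V" using D0(3) by (auto simp: V_def finite_imp_compact)
  then obtain r2 where r2: "r2 > 0" "(\<Union>z\<in>range \<mu>. ball z r2) \<subseteq> V"
    using compact_subset_open_imp_ball_epsilon_subset V(1) by metis
  obtain \<epsilon>\<^sub>T C\<^sub>0 where \<epsilon>\<^sub>T: "0 < \<epsilon>\<^sub>T"
    and ext: "\<forall>X. vec.subspace X \<and> vec.dim X = CARD('m) \<and> subspace_angle X \<U> \<le> \<epsilon>\<^sub>T \<longrightarrow>
          (\<exists>(\<rho> :: 'm \<Rightarrow> complex) x. ritz_pairs D T X \<rho> x) \<and>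
          (\<forall>(\<rho> :: 'm \<Rightarrow> complex) x. ritz_pairs D T X \<rho> x \<longrightarrow>
             (\<exists>\<pi>. bij \<pi> \<and>
               (\<forall>i. cmod (\<rho> (\<pi> i) - \<mu> i) \<le> C\<^sub>0 * subspace_angle X \<U> \<and>
                    subspace_angle (vec.span {x (\<pi> i)}) (vec.span {u i}) \<le> C\<^sub>0 * subspace_angle X \<U>)))"
    using extraction unfolding extraction_assumption_def \<U>_def by (elim exE conjE)
  \<comment> \<open>\<open>C\<^sub>0\<close> need not be positive, but \<open>C\<close> appears in denominators.\<close>
  define C where "C = max C\<^sub>0 1"
  have C: "C \<ge> 1" "C\<^sub>0 \<le> C" by (auto simp: C_def)
  define A where "A = 1 + M' * (M + L)"
  have A: "A \<ge> 1" using M(1) M'(1) L(1) by (simp add: A_def)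
  define c where "c = 4 * ?m / \<sigma> * ((1 + 2 * M + L) * C) + 8 * ?m / \<sigma>"
  have c: "c \<ge> 8 * ?m / \<sigma>" "c \<ge> 4 * ?m / \<sigma> * ((1 + 2 * M + L) * C)" "c > 0"
    using \<sigma>(1) M(1) L(1) C by (auto simp: c_def intro!: add_nonneg_pos)
  define \<epsilon> where "\<epsilon> = Min {\<epsilon>\<^sub>T, r1 / (2 * C), r2 / (2 * C), 1 / (2 * C), \<sigma> / (4 * ?m * A * C)}"
  have \<epsilon>: "\<epsilon> > 0" "\<epsilon> \<le> \<epsilon>\<^sub>T" "\<epsilon> \<le> r1 / (2 * C)" "\<epsilon> \<le> r2 / (2 * C)" "\<epsilon> \<le> 1 / (2 * C)" "\<epsilon> \<le> \<sigma> / (4 * ?m * A * C)"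
    using \<epsilon>\<^sub>T L(2) r2(1) \<sigma>(1) C A by (auto simp: \<epsilon>_def)
  show ?thesis
  proof (rule that[OF \<epsilon>(1) c(3)])
    fix X assume X: "vec.subspace X" "vec.dim X = CARD('m)" "subspace_angle X \<U> \<le> \<epsilon>"
    then have X': "subspace_angle X \<U> \<le> \<epsilon>\<^sub>T" using \<epsilon>(2) by simp
    note extX = ext[rule_format, OF conjI[OF X(1) conjI[OF X(2) X']]]
    show "\<exists>(\<rho> :: 'm \<Rightarrow> complex) x. ritz_pairs D T X \<rho> x"
      using extX by (rule conjunct1)
    fix N \<xi> \<omega> \<gamma> and \<rho> :: "'m \<Rightarrow> complex" and x
    assume nodes: "\<And>j. j \<in> {1..N} \<Longrightarrow> \<xi> j \<in> \<Omega> \<and> invertible (T (\<xi> j))"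
      and \<gamma>: "0 \<le> \<gamma>" "\<gamma> < 1 / c"
      and quad: "\<And>z. z \<in> D\<^sub>0 \<Longrightarrow>
         spectral_norm ((\<Sum>j=1..N. mscale (\<omega> j / (\<xi> j - z)) (H (\<xi> j))) - H z) \<le> \<gamma> \<and>
         spectral_norm (filter_ci g T z - filter_nl N \<xi> \<omega> T z) \<le> \<gamma>"
      and ritz: "ritz_pairs D T X \<rho> x"
    let ?F = "filter_nl N \<xi> \<omega> T"
    obtain \<pi> where \<pi>: "bij \<pi>"
      "\<And>i. cmod (\<rho> (\<pi> i) - \<mu> i) \<le> C\<^sub>0 * subspace_angle X \<U>"
      "\<And>i. subspace_angle (vec.span {x (\<pi> i)}) (vec.span {u i}) \<le> C\<^sub>0 * subspace_angle X \<U>"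
      using extX ritz by blast
    define \<alpha> where "\<alpha> = C * subspace_angle X \<U>"
    have angle0: "0 \<le> subspace_angle X \<U>"
      using X(1,2) dim\<U> by (intro subspace_angle_nonneg) (auto simp: \<U>_def vec.subspace_span)
    have C\<alpha>: "C\<^sub>0 * subspace_angle X \<U> \<le> \<alpha>"
      unfolding \<alpha>_def using C angle0 by (intro mult_right_mono)
    have \<alpha>C: "\<alpha> \<le> C * \<epsilon>" unfolding \<alpha>_def using X(3) C by (intro mult_left_mono) auto
    have C\<epsilon>: "C * \<epsilon> \<le> r1 / 2" "C * \<epsilon> \<le> r2 / 2" "C * \<epsilon> \<le> 1 / 2" "A * (C * \<epsilon>) \<le> \<sigma> / (4 * ?m)"
      using \<epsilon>(3-6) C A by (auto simp: field_simps)
    have \<alpha>: "\<alpha> < r1" "\<alpha> < r2" "\<alpha> < 1"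
      using \<alpha>C C\<epsilon>(1-3) L(2) r2(1) by auto
    have A\<alpha>: "A * \<alpha> \<le> \<sigma> / (4 * ?m)"
      by (rule order_trans[OF mult_left_mono[OF \<alpha>C] C\<epsilon>(4)]) (use A in simp)
    have near: "cmod (\<rho> (\<pi> i) - \<mu> i) \<le> \<alpha>"
      "subspace_angle (vec.span {x (\<pi> i)}) (vec.span {u i}) \<le> \<alpha>" for i
      using \<pi>(2,3) C\<alpha> order_trans by blast+
    have inV: "\<rho> (\<pi> i) \<in> V" for i
    proof -
      have "\<rho> (\<pi> i) \<in> ball (\<mu> i) r2"
        using near(1)[of i] \<alpha>(2) by (simp add: dist_norm norm_minus_commute)
      then show ?thesis using r2(2) by blast
    qed
    have "\<gamma> \<le> \<sigma> / (8 * ?m)"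
    proof -
      have "1 / c \<le> 1 / (8 * ?m / \<sigma>)" using c \<sigma>(1) by (intro divide_left_mono) auto
      then show ?thesis using \<gamma>(2) by simp
    qed
    then have small: "2 * \<gamma> + (1 + M' * (M + L)) * \<alpha> \<le> \<sigma> / (2 * ?m)"
      using A\<alpha> unfolding A_def[symmetric] by (simp add: field_simps)
    have finite_range\<mu>: "finite (range \<mu>)" by simp
    have quad_H: "spectral_norm ((\<Sum>j=1..N. mscale (\<omega> j / (\<xi> j - z)) (H (\<xi> j))) - H z) \<le> \<gamma>"
      if "z \<in> V" for z using quad[of z] that V(2) by blast
    have quad_F: "spectral_norm ((mat 1 - H z ** T z) - ?F z) \<le> \<gamma>" if "z \<in> V - range \<mu>" for z
    proof -
      have z: "z \<in> D\<^sub>0" "z \<in> D" using that V(2,3) by blast+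
      show ?thesis using quad[OF z(1)] unfolding ci[OF z(2) inv[OF that]] by (rule conjunct2)
    qed
    have est1: "norm (?F z *v v - (v - H z *v (T z *v v))) \<le> \<gamma> * norm v"
      and est2: "norm (orth_residual (vec.span (range u)) (?F z *v v))
        \<le> \<gamma> * ((1 + M) * norm (orth_residual (vec.span (range u)) v) + norm (T z *v v))"
      if "z \<in> V" for z v
      using filter_nl_estimates[OF K \<Omega> nodes V(1,4,3) finite_range\<mu> inv quad_H quad_F
          M(2)[OF subsetD[OF V(2)]] that, of v] by simp_all
    \<comment> \<open>Reordering the Ritz pairs leaves the spanned subspace unchanged.\<close>
    have range: "range (\<lambda>i. ?F (\<rho> (\<pi> i)) *v x (\<pi> i)) = range (\<lambda>i. ?F (\<rho> i) *v x i)"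
      using image_comp[of "\<lambda>i. ?F (\<rho> i) *v x i" \<pi> UNIV] by (simp add: bij_is_surj[OF \<pi>(1)] comp_def)
    note contraction = filtered_span_contraction[OF \<sigma> u(2) ritz_vector_nonzero[OF ritz] inV near
      M(2)[OF subsetD[OF V(2)]] M'(2)[OF subsetD[OF V(2)]] L(3)[OF le_less_trans[OF near(1) \<alpha>(1)]]
      M(1) M'(1) L(1) \<gamma>(1) est1 est2 \<alpha>(3) small, unfolded range]
    have "subspace_angle (vec.span (range (\<lambda>i. ?F (\<rho> i) *v x i))) \<U>
        \<le> 4 * ?m / \<sigma> * (\<gamma> * ((1 + 2 * M + L) * \<alpha>))"
      unfolding \<U>_def by (rule contraction(2))
    also have "\<dots> = 4 * ?m / \<sigma> * ((1 + 2 * M + L) * C) * (\<gamma> * subspace_angle X \<U>)"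
      by (simp add: \<alpha>_def algebra_simps)
    also have "\<dots> \<le> c * (\<gamma> * subspace_angle X \<U>)"
      using c(2) \<gamma>(1) angle0 by (intro mult_right_mono mult_nonneg_nonneg)
    finally show "vec.dim (vec.span (range (\<lambda>i. ?F (\<rho> i) *v x i))) = CARD('m) \<and>
      subspace_angle (vec.span (range (\<lambda>i. ?F (\<rho> i) *v x i))) \<U> \<le> c * \<gamma> * subspace_angle X \<U>"
      using contraction(1) by (simp add: mult.assoc)
  qed
qed

theorem corollary8:
  fixes T :: "complex \<Rightarrow> complex ^ 'n ^ 'n"
    and \<Omega> D D\<^sub>0 :: "complex set"
    and g :: "real \<Rightarrow> complex"
    and \<mu> :: "'m::finite \<Rightarrow> complex"
    and u w :: "'m \<Rightarrow> complex ^ 'n"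
    and H :: "complex \<Rightarrow> complex ^ 'n ^ 'n"
  assumes jordan: "simple_path g" "pathfinish g = pathstart g" "rectifiable_path g"
    and D_enclosed: "D = inside (path_image g)"
    and pos_oriented: "\<And>z. z \<in> D \<Longrightarrow> winding_number g z = 1"
    and Omega: "open \<Omega>" "connected \<Omega>" "closure D \<subseteq> \<Omega>"
    and T_hol: "matrix_holomorphic_on T \<Omega>"
    and T_boundary: "\<And>z. z \<in> path_image g \<Longrightarrow> invertible (T z)"
    and T_regular: "\<exists>\<xi>\<^sub>0\<in>D. det (T \<xi>\<^sub>0) \<noteq> 0"
    and eigenvalues: "inj \<mu>" "range \<mu> = eigenvalues_in D T"
    and simple: "\<And>i. simple_eigenvalue T (\<mu> i)"
    and eigenvectors: "\<And>i. eigenpair T (\<mu> i) (u i)" "\<And>i. norm (u i) = 1"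
    and independent: "inj u" "vec.independent (range u)"
    and keldysh: "keldysh_decomposition \<Omega> D T \<mu> u w H"
    and D0: "compact D\<^sub>0" "D\<^sub>0 \<subseteq> D" "\<And>i. \<mu> i \<in> interior D\<^sub>0"
    and extraction: "extraction_assumption D T \<mu> u"
  shows "\<exists>eps_nl>0. \<exists>c_nl>0.
    \<forall>N \<xi> \<omega> \<gamma> c\<^sub>T C\<^sub>T.
      (\<forall>j\<in>{1..N}. \<xi> j \<in> \<Omega> \<and> invertible (T (\<xi> j))) \<longrightarrow>
      c\<^sub>T > 0 \<longrightarrow> C\<^sub>T > 0 \<longrightarrow> \<gamma> = C\<^sub>T * exp (- c\<^sub>T * real N) \<longrightarrow> \<gamma> < 1 / c_nl \<longrightarrow>
      (\<forall>\<rho>\<in>D\<^sub>0.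
         max (spectral_norm ((\<Sum>j=1..N. mscale (\<omega> j / (\<xi> j - \<rho>)) (H (\<xi> j))) - H \<rho>))
             (spectral_norm (filter_ci g T \<rho> - filter_nl N \<xi> \<omega> T \<rho>)) \<le> \<gamma>) \<longrightarrow>
      (\<forall>X\<^sub>0. vec.subspace X\<^sub>0 \<longrightarrow> vec.dim X\<^sub>0 = CARD('m) \<longrightarrow>
         subspace_angle (vec.span (range u)) X\<^sub>0 \<le> eps_nl \<longrightarrow>
         (\<exists>X (\<rho> :: nat \<Rightarrow> 'm \<Rightarrow> complex) x. X 0 = X\<^sub>0 \<and> nlfeast D T N \<xi> \<omega> X \<rho> x) \<and>
         (\<forall>X (\<rho> :: nat \<Rightarrow> 'm \<Rightarrow> complex) x. X 0 = X\<^sub>0 \<and> nlfeast D T N \<xi> \<omega> X \<rho> x \<longrightarrow>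
            (\<forall>k. subspace_angle (X k) (vec.span (range u))
                  \<le> (c_nl * \<gamma>) ^ k * subspace_angle X\<^sub>0 (vec.span (range u)))))"
proof -
  let ?U = "vec.span (range u)"
  have D_\<Omega>: "D \<subseteq> \<Omega>" using Omega(3) closure_subset by blast
  have "path_image g = frontier D"
    using Jordan_inside_outside[OF jordan(1,2)] unfolding D_enclosed by simp
  then have g_\<Omega>: "path_image g \<subseteq> \<Omega>" using Omega(3) by (auto simp: frontier_def)
  have ci: "filter_ci g T \<rho> = mat 1 - H \<rho> ** T \<rho>" if "\<rho> \<in> D" "invertible (T \<rho>)" for \<rho>
    using filter_ci_eq[OF jordan(3,2) D_enclosed pos_oriented Omega(1) T_hol D_\<Omega> g_\<Omega> T_boundary
        eigenvalues(2) keldysh that] .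
  have "T (\<mu> i) *v u i = 0" for i using eigenvectors(1) by (simp add: eigenpair_def)
  then obtain \<epsilon> c where \<epsilon>: "\<epsilon> > 0" and c: "c > 0"
    and extractable: "\<And>X. vec.subspace X \<Longrightarrow> vec.dim X = CARD('m) \<Longrightarrow> subspace_angle X ?U \<le> \<epsilon> \<Longrightarrow>
      \<exists>(\<rho> :: 'm \<Rightarrow> complex) x. ritz_pairs D T X \<rho> x"
    and contract: "\<And>N \<xi> \<omega> \<gamma> X (\<rho> :: 'm \<Rightarrow> complex) x.
      (\<And>j. j \<in> {1..N} \<Longrightarrow> \<xi> j \<in> \<Omega> \<and> invertible (T (\<xi> j))) \<Longrightarrow> 0 \<le> \<gamma> \<Longrightarrow> \<gamma> < 1 / c \<Longrightarrow>
      (\<And>z. z \<in> D\<^sub>0 \<Longrightarrow>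
         spectral_norm ((\<Sum>j=1..N. mscale (\<omega> j / (\<xi> j - z)) (H (\<xi> j))) - H z) \<le> \<gamma> \<and>
         spectral_norm (filter_ci g T z - filter_nl N \<xi> \<omega> T z) \<le> \<gamma>) \<Longrightarrow>
      vec.subspace X \<Longrightarrow> vec.dim X = CARD('m) \<Longrightarrow> subspace_angle X ?U \<le> \<epsilon> \<Longrightarrow>
      ritz_pairs D T X \<rho> x \<Longrightarrow>
      vec.dim (vec.span (range (\<lambda>i. filter_nl N \<xi> \<omega> T (\<rho> i) *v x i))) = CARD('m) \<and>
      subspace_angle (vec.span (range (\<lambda>i. filter_nl N \<xi> \<omega> T (\<rho> i) *v x i))) ?U
        \<le> c * \<gamma> * subspace_angle X ?U"
    using nlfeast_step_contraction[OF Omega(1) T_hol D_\<Omega> eigenvalues(2) _ eigenvectors(2) independent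
        keldysh D0 ci extraction] by (smt (verit))
  show ?thesis
  proof (rule exI[of _ \<epsilon>], rule conjI[OF \<epsilon>], rule exI[of _ c], rule conjI[OF c], intro allI impI conjI)
    fix N \<xi> \<omega> \<gamma> c\<^sub>T C\<^sub>T X\<^sub>0
    assume nodes: "\<forall>j\<in>{1..N}. \<xi> j \<in> \<Omega> \<and> invertible (T (\<xi> j))"
      and "C\<^sub>T > 0" "\<gamma> = C\<^sub>T * exp (- c\<^sub>T * real N)" and \<gamma>c: "\<gamma> < 1 / c"
      and quad: "\<forall>\<rho>\<in>D\<^sub>0.
         max (spectral_norm ((\<Sum>j=1..N. mscale (\<omega> j / (\<xi> j - \<rho>)) (H (\<xi> j))) - H \<rho>))
             (spectral_norm (filter_ci g T \<rho> - filter_nl N \<xi> \<omega> T \<rho>)) \<le> \<gamma>"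
      and X0: "vec.subspace X\<^sub>0" "vec.dim X\<^sub>0 = CARD('m)" "subspace_angle ?U X\<^sub>0 \<le> \<epsilon>"
    have \<gamma>: "0 \<le> \<gamma>" using \<open>C\<^sub>T > 0\<close> \<open>\<gamma> = _\<close> by simp
    have q: "0 \<le> c * \<gamma>" "c * \<gamma> \<le> 1" using \<gamma> \<gamma>c c by (auto simp: field_simps)
    have start: "vec.subspace X\<^sub>0 \<and> vec.dim X\<^sub>0 = CARD('m) \<and> subspace_angle X\<^sub>0 ?U \<le> \<epsilon>"
      using X0 by (simp add: subspace_angle_commute)
    have step: "vec.dim (vec.span (range (\<lambda>i. filter_nl N \<xi> \<omega> T (\<rho> i) *v x i))) = CARD('m) \<and>
        subspace_angle (vec.span (range (\<lambda>i. filter_nl N \<xi> \<omega> T (\<rho> i) *v x i))) ?U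
        \<le> c * \<gamma> * subspace_angle X ?U"
      if "vec.subspace X \<and> vec.dim X = CARD('m) \<and> subspace_angle X ?U \<le> \<epsilon>" "ritz_pairs D T X \<rho> x"
      for X and \<rho> :: "'m \<Rightarrow> complex" and x
      using that nodes quad by (intro contract[OF _ \<gamma> \<gamma>c]) auto
    note convergence = nlfeast_linear_convergence[OF vec.subspace_span
        dim_span_independent_family[OF independent] q _ step start]
    show "\<exists>X (\<rho> :: nat \<Rightarrow> 'm \<Rightarrow> complex) x. X 0 = X\<^sub>0 \<and> nlfeast D T N \<xi> \<omega> X \<rho> x"
      using convergence(1) extractable by blast
    fix X and \<rho> :: "nat \<Rightarrow> 'm \<Rightarrow> complex" and x k
    assume "X 0 = X\<^sub>0 \<and> nlfeast D T N \<xi> \<omega> X \<rho> x"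
    then show "subspace_angle (X k) ?U \<le> (c * \<gamma>) ^ k * subspace_angle X\<^sub>0 ?U"
      using convergence(2) extractable by blast
  qed
qed

end
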